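(* Let $G=(V,D)$ be an acyclic process graph, and let $\mathcal G\in\mathcal T(G)$ be any time series graph with process graph $G$. Let $X,Y,Z\subset V$ be disjoint sets of process indices. Then for generic $(\Phi,\Omega)\in\mathbb R^{\mathcal G}_{\mathrm{stb}}$ (i.e. for all $(\Phi,\Omega)$ outside a set of Lebesgue measure zero) the following equivalence holds: the subprocesses $\mathbb X_X$ and $\mathbb X_Y$ of the SVAR process $\mathbb X$ with parameters $(\Phi,\Omega)$ are conditionally independent given $\mathbb X_Z$ if and only if $Z$ $d$-separates $X$ and $Y$ on $G$. In particular, the Markov equivalence class of $G$ is generically identifiable from the spectrum of the process: for all $(\Phi,\Omega)\in\mathbb R^{\mathcal G}_{\mathrm{stb}}$ outside a set of Lebesgue measure zero, the set of triples $(X,Y,Z)$ of disjoint subsets of $V$ such that $Z$ $d$-separates $X$ and $Y$ on $G$ is equal to the set of triples of disjoint subsets with $[\mathcal S(\Phi,\Omega)]_{X,Y\mid Z}=0$, which is determined by $\mathcal S(\Phi,\Omega)$.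
   Context: **Graphs.** Let $V$ be a finite set. A (stationary) time series graph over $V$ is a directed graph $\mathcal G=(V\times\mathbb Z,\mathcal D)$ such that whenever $(v(t-k),w(t))\in\mathcal D$ (an edge from $(v,t-k)$ to $(w,t)$), then $k\ge 0$ and $(v(s-k),w(s))\in\mathcal D$ for all $s\in\mathbb Z$; this is written $v\to_k w$. All time series graphs have finite order, i.e. $\max\{k: v\to_k w\}<\infty$. Auto-lags $v\to_k v$ are allowed. The process graph of $\mathcal G$ is the finite directed graph $G=(V,D)$ containing the edge $v\to w$ ($v\ne w$) iff $v\to_k w$ for some $k\ge0$ (auto-lags do not count as edges of $G$). $\mathcal T(G)$ is the set of all time series graphs with process graph $G$. **Parameters.** $\mathbb R^{\mathcal D}$ is the finite-dimensional space of coefficient families $\Phi=(\phi_{v,w}(k))_{v\to_k w}$. $\mathbb R^{\mathcal D}_{\mathrm{stb}}$ is the set of $\Phi$ with $\sum_{k}|\phi_{v,v}(k)|<1$ for every $v\in V$ and $\sum_{v,w\in V}\sum_{k:v\to_k w}|\phi_{v,w}(k)|<1$. $\mathbb R^{\mathcal G}_{\mathrm{stb}}=\mathbb R^{\mathcal D}_{\mathrm{stb}}\times\mathbb R^V_+$, where $\mathbb R^V_+$ is the set of diagonal matrices $\Omega=\mathrm{diag}((\omega_v)_{v\in V})$ with $\omega_v>0$. The SVAR process with parameters $(\Phi,\Omega)$ is the stationary process $\mathbb X_v(t)=\sum_{u}\sum_{k:u\to_k v}\phi_{u,v}(k)\mathbb X_u(t-k)+\eta_v(t)$ (sum over all $u\in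 V$, including $u=v$), with independent Gaussian white noise $\eta_v(t)$ of mean zero and variance $\omega_v$. **Spectrum.** For $r\in\mathbb R(z)$ put $r^*(z)=r(z^{-1})\in\mathbb R(z)$ (on the unit circle this is $r(\bar z)$); apply $*$ to matrices entrywise. Let $\varphi_{x,y}(z)=\sum_{k:x\to_k y}\phi_{x,y}(k)z^k$. The transfer function $H\in\mathbb R(z)^{V\times V}$ has entries $h_{v,w}=\varphi_{v,w}/(1-\varphi_{w,w})$ if $v\to w$ in $G$ and $0$ otherwise. The internal spectrum $\mathcal S^{\mathrm I}$ is the diagonal matrix with entries $\mathcal S^{\mathrm I}_v=\omega_v\,(1-\varphi_{v,v})^{-1}\left((1-\varphi_{v,v})^{-1}\right)^*$. The spectrum (spectral density) is $\mathcal S(\Phi,\Omega)=(I-H)^{-\top}\mathcal S^{\mathrm I}(I-H^* )^{-1}\in\mathbb R(z)^{V\times V}$. $[M]_{X,Y}$ denotes the submatrix with rows $X$ and columns $Y$. **Conditional independence.** For disjoint $X,Y,Z$, $\mathbb X_X$ and $\mathbb X_Y$ are conditionally independent given $\mathbb X_Z$ if $[\mathcal S]_{X,Y\mid Z}:=[\mathcal S]_{X,Y}-[\mathcal S]_{X,Z}[\mathcal S]_{Z,Z}^{-1}[\mathcal S]_{Z,Y}$ is zero in $\mathbb R(z)^{X\times Y}$. **$d$-separation.** $Z$ $d$-separates $X$ and $Y$ on the DAG $G$ if every (not necessarily directed) path between a node in $X$ and a node in $Y$ goes through a node $k$ that is either a non-collider on the path with $k\in Z$, or a collider on the path (both adjacent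 path edges point to $k$) that is not an ancestor of any node in $Z$ (each node is an ancestor of itself). Two DAGs on $V$ are Markov equivalent if they have the same $d$-separation triples. *)

theory Defs
  imports "HOL-Analysis.Analysis" "HOL-Computational_Algebra.Polynomial_Factorial"
    "HOL-Computational_Algebra.Field_as_Ring"
begin

section \<open>Time series graphs and their process graphs\<close>

text \<open>The finite index set \<open>V\<close> is the universe of a type \<open>'v\<close> of class \<^class>\<open>finite\<close>.\<close>

type_synonym 'v tsgraph = "(('v \<times> int) \<times> ('v \<times> int)) set"

definition lagged_edges :: "'v tsgraph \<Rightarrow> ('v \<times> 'v \<times> nat) set" where
  "lagged_edges \<G> = {(v, w, k). \<exists>t. ((v, t - int k), (w, t)) \<in> \<G>}"

definition ts_graph :: "'v tsgraph \<Rightarrow> bool" where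
  "ts_graph \<G> \<longleftrightarrow>
     (\<forall>v w k t. ((v, t - k), (w, t)) \<in> \<G> \<longrightarrow>
        0 \<le> k \<and> (\<forall>s. ((v, s - k), (w, s)) \<in> \<G>)) \<and>
     finite {k. \<exists>v w. (v, w, k) \<in> lagged_edges \<G>}"

definition process_graph :: "'v tsgraph \<Rightarrow> 'v rel" where
  "process_graph \<G> = {(v, w). v \<noteq> w \<and> (\<exists>k. (v, w, k) \<in> lagged_edges \<G>)}"

definition ts_graphs :: "'v rel \<Rightarrow> 'v tsgraph set" where
  "ts_graphs G = {\<G>. ts_graph \<G> \<and> process_graph \<G> = G}"


section \<open>d-separation and Markov equivalence\<close>

definition is_path :: "'v rel \<Rightarrow> 'v list \<Rightarrow> bool" where
  "is_path G p \<longleftrightarrow> p \<noteq> [] \<and> distinct p \<and> successively (\<lambda>a b. (a, b) \<in> G \<or> (b, a) \<in> G) p"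

definition collider_at :: "'v rel \<Rightarrow> 'v list \<Rightarrow> nat \<Rightarrow> bool" where
  "collider_at G p i \<longleftrightarrow> 0 < i \<and> Suc i < length p \<and>
     (p ! (i - 1), p ! i) \<in> G \<and> (p ! Suc i, p ! i) \<in> G"

definition blocked :: "'v rel \<Rightarrow> 'v set \<Rightarrow> 'v list \<Rightarrow> bool" where
  "blocked G Z p \<longleftrightarrow> (\<exists>i < length p.
     \<not> collider_at G p i \<and> p ! i \<in> Z \<or>
     collider_at G p i \<and> \<not> (\<exists>z\<in>Z. (p ! i, z) \<in> G\<^sup>*))"

definition d_separates :: "'v rel \<Rightarrow> 'v set \<Rightarrow> 'v set \<Rightarrow> 'v set \<Rightarrow> bool" where
  "d_separates G Z X Y \<longleftrightarrow>
     (\<forall>p. is_path G p \<and> hd p \<in> X \<and> last p \<in> Y \<longrightarrow> blocked G Z p)"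

definition disjoint_triple :: "'v set \<Rightarrow> 'v set \<Rightarrow> 'v set \<Rightarrow> bool" where
  "disjoint_triple X Y Z \<longleftrightarrow> X \<inter> Y = {} \<and> X \<inter> Z = {} \<and> Y \<inter> Z = {}"

definition dsep_triples :: "'v rel \<Rightarrow> ('v set \<times> 'v set \<times> 'v set) set" where
  "dsep_triples G = {(X, Y, Z). disjoint_triple X Y Z \<and> d_separates G Z X Y}"

definition markov_equivalent :: "'v rel \<Rightarrow> 'v rel \<Rightarrow> bool" where
  "markov_equivalent G G' \<longleftrightarrow> dsep_triples G = dsep_triples G'"

definition markov_class :: "'v rel \<Rightarrow> 'v rel set" where
  "markov_class G = {G'. acyclic G' \<and> markov_equivalent G G'}"


section \<open>Parameters of the SVAR process\<close>

text \<open>\<open>\<Phi> (v, w, k)\<close> is the coefficient \<open>\<phi>\<^sub>v\<^sub>,\<^sub>w(k)\<close>; as an element of a finite product space,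
  \<open>\<Phi>\<close> takes the dummy value \<^const>\<open>undefined\<close> outside the lagged edges.
  \<open>\<Omega> v\<close> is the \<open>v\<close>-th diagonal entry of the noise covariance.\<close>

type_synonym 'v coeffs = "'v \<times> 'v \<times> nat \<Rightarrow> real"
type_synonym 'v noise = "'v \<Rightarrow> real"

definition param_stb :: "('v::finite) tsgraph \<Rightarrow> ('v coeffs \<times> 'v noise) set" where
  "param_stb \<G> =
     {\<Phi> \<in> lagged_edges \<G> \<rightarrow>\<^sub>E UNIV.
        (\<forall>v. (\<Sum>k | (v, v, k) \<in> lagged_edges \<G>. \<bar>\<Phi> (v, v, k)\<bar>) < 1) \<and>
        (\<Sum>e\<in>lagged_edges \<G>. \<bar>\<Phi> e\<bar>) < 1}
     \<times> {\<Omega>. \<forall>v. 0 < \<Omega> v}"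

text \<open>Lebesgue measure on the parameter space. It is the Borel version; \<open>AE\<close> statements about it
  are the same as about its completion.\<close>

definition param_measure :: "('v::finite) tsgraph \<Rightarrow> ('v coeffs \<times> 'v noise) measure" where
  "param_measure \<G> = (\<Pi>\<^sub>M e\<in>lagged_edges \<G>. lborel) \<Otimes>\<^sub>M (\<Pi>\<^sub>M v\<in>UNIV. lborel)"


section \<open>The spectrum as a matrix of rational functions\<close>

type_synonym ratfun = "real poly fract"

definition rf_const :: "real \<Rightarrow> ratfun" where
  "rf_const c = to_fract [:c:]"

definition rf_z :: ratfun where
  "rf_z = to_fract [:0, 1:]"

definition poly_at_inverse :: "real poly \<Rightarrow> ratfun" where
  "poly_at_inverse p = poly (map_poly rf_const p) (inverse rf_z)"

text \<open>The involution \<open>r\<^sup>*(z) = r(z\<inverse>)\<close>, computed on the normalised representative of \<open>r\<close>;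
  lemma \<open>rf_star_Fract\<close> below shows independence of the representative.\<close>

definition rf_star :: "ratfun \<Rightarrow> ratfun" where
  "rf_star r = poly_at_inverse (fst (quot_of_fract r)) / poly_at_inverse (snd (quot_of_fract r))"

lemma rf_const_0 [simp]: "rf_const 0 = 0"
  by (simp add: rf_const_def)

lemma rf_const_add: "rf_const (a + b) = rf_const a + rf_const b"
  by (simp add: rf_const_def flip: to_fract_add)

lemma rf_const_mult: "rf_const (a * b) = rf_const a * rf_const b"
  by (simp add: rf_const_def flip: to_fract_mult)

lemma rf_z_nonzero [simp]: "rf_z \<noteq> 0"
  by (simp add: rf_z_def)

lemma rf_z_power: "rf_z ^ n = to_fract ([:0, 1:] ^ n)"
  by (induction n) (simp_all add: rf_z_def del: mult_pCons_left mult_pCons_right flip: to_fract_mult)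

lemma poly_at_inverse_0 [simp]: "poly_at_inverse 0 = 0"
  by (simp add: poly_at_inverse_def)

lemma poly_at_inverse_pCons:
  "poly_at_inverse (pCons a p) = rf_const a + inverse rf_z * poly_at_inverse p"
  by (simp add: poly_at_inverse_def map_poly_pCons)

lemma poly_at_inverse_add: "poly_at_inverse (p + q) = poly_at_inverse p + poly_at_inverse q"
  by (induction p q rule: poly_induct2) (simp_all add: poly_at_inverse_pCons rf_const_add algebra_simps)

lemma poly_at_inverse_smult: "poly_at_inverse (smult a q) = rf_const a * poly_at_inverse q"
  by (induction q) (simp_all add: poly_at_inverse_pCons rf_const_mult algebra_simps)

lemma poly_at_inverse_mult: "poly_at_inverse (p * q) = poly_at_inverse p * poly_at_inverse q"
  by (induction p)
     (simp_all add: poly_at_inverse_add poly_at_inverse_smult poly_at_inverse_pCons algebra_simps)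

lemma poly_at_inverse_times_power:
  "\<exists>q. poly_at_inverse p * rf_z ^ degree p = to_fract q \<and> coeff q 0 = lead_coeff p"
proof (induction p)
  case 0
  then show ?case by (intro exI[of _ 0]) simp
next
  case (pCons a p)
  show ?case
  proof (cases "p = 0")
    case True
    then show ?thesis
      by (intro exI[of _ "[:a:]"]) (simp add: poly_at_inverse_pCons rf_const_def)
  next
    case False
    obtain q where q: "poly_at_inverse p * rf_z ^ degree p = to_fract q" "coeff q 0 = lead_coeff p"
      using pCons.IH by blast
    have "poly_at_inverse (pCons a p) * rf_z ^ degree (pCons a p) =
        rf_const a * rf_z ^ Suc (degree p) + poly_at_inverse p * rf_z ^ degree p"
      using False by (simp add: poly_at_inverse_pCons field_simps)
    also have "\<dots> = to_fract ([:a:] * [:0, 1:] ^ Suc (degree p) + q)"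
      by (simp only: q(1)[unfolded rf_z_power] rf_const_def rf_z_power to_fract_add to_fract_mult)
    finally show ?thesis
      using False q(2) by (intro exI[of _ "[:a:] * [:0, 1:] ^ Suc (degree p) + q"]) simp
  qed
qed

lemma poly_at_inverse_eq_0_iff [simp]: "poly_at_inverse p = 0 \<longleftrightarrow> p = 0"
proof
  assume "poly_at_inverse p = 0"
  then show "p = 0"
    using poly_at_inverse_times_power[of p] by auto
qed simp

lemma rf_star_Fract:
  assumes "q \<noteq> 0"
  shows "rf_star (Fract p q) = poly_at_inverse p / poly_at_inverse q"
proof -
  define a b where "a = fst (quot_of_fract (Fract p q))" and "b = snd (quot_of_fract (Fract p q))"
  have b: "b \<noteq> 0"
    by (simp add: b_def)
  have "Fract a b = Fract p q"
    by (simp add: a_def b_def)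
  then have "a * q = p * b"
    using assms b by (simp add: eq_fract)
  then have "poly_at_inverse a * poly_at_inverse q = poly_at_inverse p * poly_at_inverse b"
    by (metis poly_at_inverse_mult)
  then show ?thesis
    using assms b by (simp add: rf_star_def frac_eq_eq flip: a_def b_def)
qed

definition lag_poly :: "'v tsgraph \<Rightarrow> 'v coeffs \<Rightarrow> 'v \<Rightarrow> 'v \<Rightarrow> ratfun" where
  "lag_poly \<G> \<Phi> x y = to_fract (\<Sum>k | (x, y, k) \<in> lagged_edges \<G>. monom (\<Phi> (x, y, k)) k)"

definition transfer_function :: "('v::finite) tsgraph \<Rightarrow> 'v coeffs \<Rightarrow> ratfun ^ 'v ^ 'v" where
  "transfer_function \<G> \<Phi> = (\<chi> v w.
     if (v, w) \<in> process_graph \<G> then lag_poly \<G> \<Phi> v w / (1 - lag_poly \<G> \<Phi> w w) else 0)"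

definition internal_spectrum ::
  "('v::finite) tsgraph \<Rightarrow> 'v coeffs \<Rightarrow> 'v noise \<Rightarrow> ratfun ^ 'v ^ 'v" where
  "internal_spectrum \<G> \<Phi> \<Omega> = (\<chi> v w.
     if v = w
     then rf_const (\<Omega> v) * inverse (1 - lag_poly \<G> \<Phi> v v) * rf_star (inverse (1 - lag_poly \<G> \<Phi> v v))
     else 0)"

definition spectrum ::
  "('v::finite) tsgraph \<Rightarrow> 'v coeffs \<Rightarrow> 'v noise \<Rightarrow> ratfun ^ 'v ^ 'v" where
  "spectrum \<G> \<Phi> \<Omega> =
     transpose (matrix_inv (mat 1 - transfer_function \<G> \<Phi>))
     ** internal_spectrum \<G> \<Phi> \<Omega>
     ** matrix_inv (mat 1 - map_matrix rf_star (transfer_function \<G> \<Phi>))"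


section \<open>Conditional independence\<close>

text \<open>The submatrix \<open>[M]\<^sub>X\<^sub>,\<^sub>Y\<close> is represented as a \<open>V \<times> V\<close> matrix padded with zeros outside
  \<open>X \<times> Y\<close>. Products of blocks with matching index sets are then products of padded matrices, and
  the inverse of \<open>[M]\<^sub>Z\<^sub>,\<^sub>Z\<close> is the two-sided inverse relative to the padded identity of \<open>Z\<close>;
  as for \<^const>\<open>matrix_inv\<close>, it is unspecified if the block is singular, which does not happen
  for the spectrum at stable parameters.\<close>

definition block :: "'v set \<Rightarrow> 'v set \<Rightarrow> 'a::zero ^ 'v ^ 'v \<Rightarrow> 'a ^ 'v ^ 'v" where
  "block X Y M = (\<chi> i j. if i \<in> X \<and> j \<in> Y then M $ i $ j else 0)"

definition block_inv :: "'v set \<Rightarrow> 'a::semiring_1 ^ 'v ^ 'v \<Rightarrow> 'a ^ 'v ^ 'v" where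
  "block_inv Z M = (SOME N. block Z Z N = N \<and>
     block Z Z M ** N = block Z Z (mat 1) \<and> N ** block Z Z M = block Z Z (mat 1))"

definition cond_spectrum ::
  "ratfun ^ 'v ^ 'v \<Rightarrow> 'v set \<Rightarrow> 'v set \<Rightarrow> 'v set \<Rightarrow> ratfun ^ 'v ^ 'v" where
  "cond_spectrum S X Y Z = block X Y S - block X Z S ** block_inv Z S ** block Z Y S"

definition cond_indep :: "ratfun ^ 'v ^ 'v \<Rightarrow> 'v set \<Rightarrow> 'v set \<Rightarrow> 'v set \<Rightarrow> bool" where
  "cond_indep S X Y Z \<longleftrightarrow> cond_spectrum S X Y Z = 0"

definition ci_triples :: "ratfun ^ 'v ^ 'v \<Rightarrow> ('v set \<times> 'v set \<times> 'v set) set" where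
  "ci_triples S = {(X, Y, Z). disjoint_triple X Y Z \<and> cond_indep S X Y Z}"

end

theory Submission
  imports Defs
begin

text \<open>Both \<open>d\<close>-separation and the vanishing of the conditional spectrum are read off from one
and the same object, the Bayes ball. Fix \<open>y \<notin> Z\<close>. A ball starts at \<open>y\<close> and moves along edges; it passes
a node outside \<open>Z\<close> unless it came in and leaves through arrowheads, and it bounces back from a node of
\<open>Z\<close> that it enters through an arrowhead. The position of the ball is a node together with a
direction, so there are two states per node. The node \<open>x\<close> is reached iff some path between \<open>x\<close> and \<open>y\<close>
is not blocked by \<open>Z\<close> (\<open>d_separates_iff_ball\<close>); this is the combinatorial half.

For the algebraic half, let \<open>P = I - \<phi>\<close> with \<open>\<phi>\<close> the matrix of lag polynomials (auto-lags included) and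
\<open>P' = P\<^sup>*\<close>, so that the spectrum \<open>S\<close> satisfies \<open>P\<^sup>T S P' = diag \<omega>\<close> (\<open>spectrum_factorization\<close>). The entry
\<open>(x, y)\<close> of the conditional spectrum is \<open>(S u)\<^sub>x\<close>, where \<open>u\<close> is the vector with \<open>u\<^sub>y = 1\<close>, supported on
\<open>Z \<union> {y}\<close>, such that \<open>S u\<close> vanishes on \<open>Z\<close>. With \<open>a = P'\<^sup>-\<^sup>1 u\<close> and \<open>s = S u\<close> this says
\<open>P' a = u\<close> and \<open>P\<^sup>T s = diag \<omega> a\<close>. Eliminating the unknown values of \<open>u\<close> on \<open>Z\<close> leaves a square linear
system \<open>Q \<xi> = e\<^sub>y\<close> whose unknowns are indexed by the states of the ball, and whose off-diagonal
coefficients, as far as they can be nonzero, correspond to the moves of the ball; the wanted entry is a coordinate of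
\<open>\<xi>\<close> (\<open>cond_spectrum_ball_system\<close>).

\<^item> If \<open>Q\<close> is invertible, \<open>\<xi>\<close> is supported on the states that the ball reaches. Hence \<open>d\<close>-separation
  implies conditional independence (\<open>ball_matrix_soundness\<close>).

\<^item> For the converse, specialise \<open>z\<close> to \<open>1\<close>. Then \<open>det Q\<close> and the numerator of \<open>\<xi>\<^sub>x\<close> in Cramer's rule are
  polynomials in the real parameters, so each vanishes on a null set only, or identically. To exclude
  the latter it suffices to inspect any real point, stable or not. Take all coefficients equal to \<open>1\<close>
  except for vanishing auto-lags, and noise variances \<open>1\<close> outside \<open>Z\<close> but a large negative number on \<open>Z\<close>.
  The negative sign offsets the alternating sign that each collider contributes, so \<open>Q\<close> becomes an
  M-matrix: no cancellation occurs, and \<open>\<xi>\<close> is positive at every state the ball reaches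
  (\<open>ball_matrix_positive_point\<close>).\<close>

section \<open>Bayes ball and d-separation\<close>

text \<open>In state \<open>Inl v\<close> the ball may leave \<open>v\<close> against an arrow; in state \<open>Inr v\<close> it has come to \<open>v\<close> along an
arrow or is about to leave along one. Turning round at a node is a separate move, because the two
states of a node carry two separate unknowns of the linear system below.\<close>

inductive bayes_ball :: "'v rel \<Rightarrow> 'v set \<Rightarrow> 'v \<Rightarrow> 'v + 'v \<Rightarrow> bool" for G Z y where
  source: "bayes_ball G Z y (Inl y)"
| up: "bayes_ball G Z y (Inl v) \<Longrightarrow> (u, v) \<in> G \<Longrightarrow> u \<notin> Z \<Longrightarrow> bayes_ball G Z y (Inl u)"
| turn_down: "bayes_ball G Z y (Inl v) \<Longrightarrow> v \<notin> Z \<Longrightarrow> bayes_ball G Z y (Inr v)"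
| down: "bayes_ball G Z y (Inr v) \<Longrightarrow> v \<notin> Z \<Longrightarrow> (v, w) \<in> G \<Longrightarrow> bayes_ball G Z y (Inr w)"
| turn_up: "bayes_ball G Z y (Inr v) \<Longrightarrow> v \<in> Z \<Longrightarrow> bayes_ball G Z y (Inl v)"

text \<open>The condition of an unblocked path at its inner nodes only. The recursion makes it stable under
taking suffixes, whereas an end node of a suffix may well lie in \<open>Z\<close>.\<close>

fun passes :: "'v rel \<Rightarrow> 'v set \<Rightarrow> 'v list \<Rightarrow> bool" where
  "passes G Z (a # b # c # p) \<longleftrightarrow>
     (if (a, b) \<in> G \<and> (c, b) \<in> G then \<exists>z\<in>Z. (b, z) \<in> G\<^sup>* else b \<notin> Z) \<and> passes G Z (b # c # p)"
| "passes G Z p \<longleftrightarrow> True"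

lemma passes_iff_nth:
  "passes G Z p \<longleftrightarrow> (\<forall>i. 0 < i \<and> Suc i < length p \<longrightarrow>
     (if collider_at G p i then \<exists>z\<in>Z. (p ! i, z) \<in> G\<^sup>* else p ! i \<notin> Z))"
proof (induction G Z p rule: passes.induct)
  case (1 G Z a b c p)
  show ?case
    unfolding passes.simps 1
    apply (rule iffI)
    subgoal
      apply (intro allI impI)
      subgoal for i
        apply (cases i)
         apply simp
        subgoal for j
          apply (cases j)
           apply (auto simp: collider_at_def)[1]
          apply (auto simp: collider_at_def)
          done
        done
      done
    subgoal premises prem
      apply (rule conjI)
      subgoal using prem[rule_format, of 1] by (auto simp: collider_at_def split: if_splits)
      subgoal
        apply (intro allI impI)
        subgoal for i
          using prem[rule_format, of "Suc i"] by (cases i) (auto simp: collider_at_def)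
        done
      done
    done
qed auto

lemma not_blocked_iff_passes:
  assumes "p \<noteq> []"
  shows "\<not> blocked G Z p \<longleftrightarrow> hd p \<notin> Z \<and> last p \<notin> Z \<and> passes G Z p"
proof -
  have ends: "\<not> collider_at G p 0" "\<not> collider_at G p (length p - 1)"
    using assms by (auto simp: collider_at_def)
  have "\<not> blocked G Z p \<longleftrightarrow>
      (\<forall>i<length p. if collider_at G p i then \<exists>z\<in>Z. (p ! i, z) \<in> G\<^sup>* else p ! i \<notin> Z)"
    by (auto simp: blocked_def)
  also have "\<dots> \<longleftrightarrow> p ! 0 \<notin> Z \<and> p ! (length p - 1) \<notin> Z \<and>
      (\<forall>i. 0 < i \<and> Suc i < length p \<longrightarrow>
        (if collider_at G p i then \<exists>z\<in>Z. (p ! i, z) \<in> G\<^sup>* else p ! i \<notin> Z))"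
    (is "?L \<longleftrightarrow> ?R")
  proof
    assume L: ?L
    show ?R
      using L[rule_format, of 0] L[rule_format, of "length p - 1"] L ends assms by auto
  next
    assume R: ?R
    show ?L
    proof (intro allI impI)
      fix i assume "i < length p"
      then consider "i = 0" | "i = length p - 1" | "0 < i" "Suc i < length p" by linarith
      then show "if collider_at G p i then \<exists>z\<in>Z. (p ! i, z) \<in> G\<^sup>* else p ! i \<notin> Z"
        using R ends by cases auto
    qed
  qed
  finally show ?thesis
    using assms by (simp add: passes_iff_nth hd_conv_nth last_conv_nth)
qed

text \<open>A collider only has to be an ancestor of \<open>Z\<close>: the ball runs down to the first node of \<open>Z\<close> and returns
the same way.\<close>

lemma ball_turns_at_ancestor:
  assumes "(v, z) \<in> G\<^sup>*" "z \<in> Z" "bayes_ball G Z y (Inr v)"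
  shows "bayes_ball G Z y (Inl v)"
  using assms
proof (induction rule: converse_rtrancl_induct)
  case base
  then show ?case by (simp add: bayes_ball.turn_up)
next
  case (step v w)
  show ?case
  proof (cases "v \<in> Z")
    case True
    then show ?thesis using step.prems bayes_ball.turn_up by metis
  next
    case False
    then have "bayes_ball G Z y (Inr w)" using step bayes_ball.down by metis
    then show ?thesis using step False bayes_ball.up by metis
  qed
qed

text \<open>The path, read towards its head, arrives there through an arrowhead.\<close>

fun headed :: "'v rel \<Rightarrow> 'v list \<Rightarrow> bool" where
  "headed G (a # b # p) \<longleftrightarrow> (b, a) \<in> G"
| "headed G p \<longleftrightarrow> False"

lemma acyclic_asym: "acyclic G \<Longrightarrow> (a, b) \<in> G \<Longrightarrow> (b, a) \<notin> G"
  by (meson acyclic_def trancl.simps)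

text \<open>The path is traversed from its last node to its head. Whether the head lies in \<open>Z\<close> matters only for a
tail there, since a collider may lie in \<open>Z\<close>.\<close>

lemma ball_follows_path:
  assumes "acyclic G" "y \<notin> Z"
    and "p \<noteq> []" "successively (\<lambda>a b. (a, b) \<in> G \<or> (b, a) \<in> G) p" "passes G Z p" "last p = y"
  shows "if headed G p then bayes_ball G Z y (Inr (hd p))
    else hd p \<notin> Z \<longrightarrow> bayes_ball G Z y (Inl (hd p))"
  using assms(3-)
proof (induction p)
  case Nil
  then show ?case by simp
next
  case (Cons a p)
  show ?case
  proof (cases p)
    case Nil
    then show ?thesis using Cons.prems by (auto intro: bayes_ball.source)
  next
    case p: (Cons b q)
    have "passes G Z p" using Cons.prems p by (cases q) auto
    then have IH: "if headed G p then bayes_ball G Z y (Inr b) else b \<notin> Z \<longrightarrow> bayes_ball G Z y (Inl b)"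
      using Cons p by auto
    have noncollider: "b \<notin> Z" if "(b, a) \<in> G \<or> \<not> headed G p"
      using Cons.prems p that acyclic_asym[OF assms(1)] assms(2)
      by (cases q) (auto split: if_splits)
    show ?thesis
    proof (cases "(b, a) \<in> G")
      case True
      then have b: "b \<notin> Z" using noncollider by blast
      then have "bayes_ball G Z y (Inr b)"
        using IH bayes_ball.turn_down by (metis (full_types))
      then have "bayes_ball G Z y (Inr a)" using b True bayes_ball.down by metis
      then show ?thesis using p True by simp
    next
      case False
      then have ab: "(a, b) \<in> G" using Cons.prems p by auto
      have "bayes_ball G Z y (Inl b)"
      proof (cases "headed G p")
        case True
        then obtain c q' where q: "q = c # q'" "(c, b) \<in> G" using p by (cases q) auto
        then obtain z where "z \<in> Z" "(b, z) \<in> G\<^sup>*" using Cons.prems p ab by auto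
        then show ?thesis using ball_turns_at_ancestor IH True by (metis (full_types))
      next
        case False
        then show ?thesis using IH noncollider by auto
      qed
      then have "a \<notin> Z \<longrightarrow> bayes_ball G Z y (Inl a)" using ab bayes_ball.up by metis
      then show ?thesis using p False by simp
    qed
  qed
qed

lemma passes_appendD: "passes G Z (q @ s) \<Longrightarrow> passes G Z s"
proof (induction q)
  case (Cons a q)
  then show ?case by (cases "q @ s" rule: remdups_adj.cases) auto
qed simp

lemma passes_appendE:
  assumes "passes G Z (q @ a # b # c # s)"
  shows "if (a, b) \<in> G \<and> (c, b) \<in> G then \<exists>z\<in>Z. (b, z) \<in> G\<^sup>* else b \<notin> Z"
  using passes_appendD[OF assms] by simp

lemma is_path_appendD: "is_path G (q @ s) \<Longrightarrow> s \<noteq> [] \<Longrightarrow> is_path G s"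
  by (auto simp: is_path_def successively_append_iff)

text \<open>Follow the path from \<open>v\<close> back towards its head: if the edge leaves \<open>v\<close>, the arrows either continue up
to a collider, which is an ancestor of \<open>Z\<close>, or up to the head of the path. So \<open>v\<close> may serve as a collider
after the path has been cut there.\<close>

lemma headed_inner_ancestor:
  assumes "acyclic G"
    and "q \<noteq> []" "is_path G (q @ v # s)" "passes G Z (q @ v # s)" "headed G (v # s)"
    and "headed G (q @ v # s) \<longrightarrow> (\<exists>z\<in>Z. (hd q, z) \<in> G\<^sup>*)"
  shows "\<exists>z\<in>Z. (v, z) \<in> G\<^sup>*"
  using assms(2-)
proof (induction q arbitrary: v s rule: rev_induct)
  case Nil
  then show ?case by simp
next
  case (snoc b q)
  obtain c s' where s: "s = c # s'" "(c, v) \<in> G" using snoc.prems by (cases s) auto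
  show ?case
  proof (cases "(b, v) \<in> G")
    case True
    have "passes G Z (q @ b # v # c # s')" using snoc.prems s by simp
    from passes_appendE[OF this] show ?thesis using True s by auto
  next
    case False
    have "is_path G (q @ b # v # s)" using snoc.prems by simp
    then have "is_path G (b # v # s)" using is_path_appendD by blast
    then have vb: "(v, b) \<in> G" using False by (auto simp: is_path_def)
    have "\<exists>z\<in>Z. (b, z) \<in> G\<^sup>*"
    proof (cases "q = []")
      case True
      then show ?thesis using snoc.prems vb by auto
    next
      case False
      show ?thesis
        by (rule snoc.IH[of b "v # s"]) (use False snoc.prems vb in auto)
    qed
    then show ?thesis using vb by (meson converse_rtrancl_into_rtrancl)
  qed
qed

text \<open>A run of the ball may visit nodes repeatedly. A genuine path arises by cutting it at a revisited node,
which may turn a non-collider into a collider. The invariant for \<open>Inl v\<close> therefore allows \<open>v\<close> to be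
entered through an arrowhead if it is an ancestor of \<open>Z\<close>; then it is admissible as a collider.\<close>

lemma ball_leaves_path:
  assumes "acyclic G" "y \<notin> Z" "bayes_ball G Z y t"
  shows "\<exists>p. is_path G p \<and> passes G Z p \<and> last p = y \<and>
    (case t of
       Inl v \<Rightarrow> hd p = v \<and> (if headed G p then \<exists>z\<in>Z. (v, z) \<in> G\<^sup>* else v \<notin> Z)
     | Inr v \<Rightarrow> hd p = v \<and> (headed G p \<or> v \<notin> Z))"
  using assms(3)
proof induction
  case source
  show ?case using assms(2) by (intro exI[of _ "[y]"]) (auto simp: is_path_def)
next
  case (up v u)
  then obtain p where p: "is_path G p" "passes G Z p" "last p = y" "hd p = v"
    "if headed G p then \<exists>z\<in>Z. (v, z) \<in> G\<^sup>* else v \<notin> Z" by auto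
  then obtain s where s: "p = v # s" by (cases p) (auto simp: is_path_def)
  have uv: "u \<noteq> v" using up(2) assms(1) by (auto simp: acyclic_def)
  show ?case
  proof (cases "u \<in> set p")
    case True
    then obtain q r where qr: "p = q @ u # r" by (meson split_list)
    have q: "q \<noteq> []" "hd q = v" using qr s uv by (cases q; auto)+
    have "headed G (u # r) \<Longrightarrow> \<exists>z\<in>Z. (u, z) \<in> G\<^sup>*"
      by (rule headed_inner_ancestor[OF assms(1) q(1)]) (use p qr q in auto)
    then show ?thesis
      using p qr up passes_appendD[of G Z q "u # r"] is_path_appendD[of G q "u # r"]
      by (intro exI[of _ "u # r"]) auto
  next
    case False
    have "passes G Z (u # p)"
      using p s up(2) by (cases s) (auto split: if_splits)
    moreover have "is_path G (u # p)" using p s up(2) False by (auto simp: is_path_def)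
    moreover have "\<not> headed G (u # p)" using s up(2) acyclic_asym[OF assms(1)] by auto
    ultimately show ?thesis
      using p s up by (intro exI[of _ "u # p"]) auto
  qed
next
  case (turn_down v)
  then show ?case by auto
next
  case (down v w)
  then obtain p where p: "is_path G p" "passes G Z p" "last p = y" "hd p = v" by auto
  then obtain s where s: "p = v # s" by (cases p) (auto simp: is_path_def)
  have vw: "w \<noteq> v" "(w, v) \<notin> G"
    using down assms(1) acyclic_asym[OF assms(1)] by (auto simp: acyclic_def)
  show ?case
  proof (cases "w \<in> set p")
    case True
    then obtain q r where qr: "p = q @ w # r" by (meson split_list)
    have q: "q \<noteq> []" using qr s vw by auto
    have "headed G (w # r) \<or> w \<notin> Z"
    proof (cases r)
      case Nil
      then show ?thesis using p qr assms(2) by auto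
    next
      case (Cons c r')
      have "p = butlast q @ last q # w # c # r'" using q by (simp add: qr Cons)
      then have "passes G Z (butlast q @ last q # w # c # r')" using p by simp
      from passes_appendE[OF this] show ?thesis using Cons by (auto split: if_splits)
    qed
    then show ?thesis
      using p qr passes_appendD[of G Z q "w # r"] is_path_appendD[of G q "w # r"]
      by (intro exI[of _ "w # r"]) auto
  next
    case False
    have "passes G Z (w # p)"
      using p s vw down by (cases s) auto
    moreover have "is_path G (w # p)" using p s down False by (auto simp: is_path_def)
    ultimately show ?thesis
      using p s down by (intro exI[of _ "w # p"]) auto
  qed
next
  case (turn_up v)
  then show ?case by (auto split: if_splits)
qed

theorem d_separates_iff_ball:
  assumes "acyclic G" and "X \<inter> Z = {}" "Y \<inter> Z = {}"
  shows "d_separates G Z X Y \<longleftrightarrow> (\<forall>x\<in>X. \<forall>y\<in>Y. \<not> bayes_ball G Z y (Inr x))"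
proof
  assume sep: "d_separates G Z X Y"
  show "\<forall>x\<in>X. \<forall>y\<in>Y. \<not> bayes_ball G Z y (Inr x)"
  proof (intro ballI notI)
    fix x y assume xy: "x \<in> X" "y \<in> Y" "bayes_ball G Z y (Inr x)"
    then have Z: "x \<notin> Z" "y \<notin> Z" using assms by auto
    then obtain p where p: "is_path G p" "passes G Z p" "last p = y" "hd p = x"
      using ball_leaves_path[OF assms(1) _ xy(3)] by auto
    then have "\<not> blocked G Z p" using Z not_blocked_iff_passes[of p] by (auto simp: is_path_def)
    then show False using sep p xy by (auto simp: d_separates_def)
  qed
next
  assume nb: "\<forall>x\<in>X. \<forall>y\<in>Y. \<not> bayes_ball G Z y (Inr x)"
  show "d_separates G Z X Y"
    unfolding d_separates_def
  proof (intro allI impI; elim conjE; rule ccontr)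
    fix p assume p: "is_path G p" "hd p \<in> X" "last p \<in> Y" "\<not> blocked G Z p"
    then have q: "p \<noteq> []" "passes G Z p" "hd p \<notin> Z" "last p \<notin> Z"
      using not_blocked_iff_passes[of p G Z] by (auto simp: is_path_def)
    have "if headed G p then bayes_ball G Z (last p) (Inr (hd p))
        else hd p \<notin> Z \<longrightarrow> bayes_ball G Z (last p) (Inl (hd p))"
      by (rule ball_follows_path) (use assms p q in \<open>auto simp: is_path_def\<close>)
    then have "bayes_ball G Z (last p) (Inr (hd p))"
      using q(3) by (auto split: if_splits intro: bayes_ball.turn_down)
    then show False using nb p by auto
  qed
qed


section \<open>Invertible, acyclic and M-matrices\<close>

lemma matrix_inv_inverse:
  assumes "invertible A"
  shows "A ** matrix_inv A = mat 1" "matrix_inv A ** A = mat 1"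
  using someI_ex[OF assms[unfolded invertible_def]] by (simp_all add: matrix_inv_def)

text \<open>The vectors that vanish on \<open>N\<close> form a subspace that \<open>Q\<close> maps into itself, injectively and thus, by
dimension, onto itself. So the inverse preserves it, too.\<close>

lemma inverse_preserves_coordinate_subspace:
  fixes Q :: "'a::field ^ 'n ^ 'n"
  assumes "invertible Q" and "\<And>i j. i \<in> N \<Longrightarrow> j \<notin> N \<Longrightarrow> Q $ i $ j = 0"
    and "\<And>i. i \<in> N \<Longrightarrow> (Q *v x) $ i = 0" and "i \<in> N"
  shows "x $ i = 0"
proof -
  define W :: "('a ^ 'n) set" where "W = {x. \<forall>i\<in>N. x $ i = 0}"
  have W: "vec.subspace W"
    by (auto simp: vec.subspace_def W_def)
  have inj: "inj ((*v) Q)"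
    using assms(1) by (metis invertible_left_inverse matrix_left_invertible_injective)
  have "(Q *v w) $ i = 0" if "w \<in> W" "i \<in> N" for w i
  proof -
    have *: "Q $ i $ j * w $ j = 0" for j
      using that assms(2)[of i j] by (cases "j \<in> N") (auto simp: W_def)
    show ?thesis by (simp only: matrix_vector_mult_def vec_lambda_beta * sum.neutral_const)
  qed
  then have sub: "(*v) Q ` W \<subseteq> W"
    by (auto simp: W_def)
  have lin: "Vector_Spaces.linear (*s) (*s) ((*v) Q)"
    by (rule matrix_vector_mul_linear_gen)
  have "vec.dim ((*v) Q ` W) = vec.dim W"
    by (rule vec.dim_image_eq[OF lin]) (use inj inj_on_subset in blast)
  then have "(*v) Q ` W = W"
    by (intro vec.subspace_dim_equal[OF _ W sub]) (auto intro: vec.linear_subspace_image[OF lin W])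
  moreover have "Q *v x \<in> W"
    using assms(3) by (auto simp: W_def)
  ultimately have "x \<in> W"
    using inj by (metis (no_types, lifting) image_iff injD)
  then show ?thesis
    using assms(4) by (auto simp: W_def)
qed

text \<open>Monotonicity of M-matrices, with the positive vector \<open>\<psi>\<close> as certificate: at an index where the ratio
\<open>x\<^sub>i / \<psi>\<^sub>i\<close> is minimal and negative, \<open>Q x\<close> would be negative.\<close>

lemma M_matrix_nonneg:
  fixes Q :: "real ^ 'n ^ 'n"
  assumes off: "\<And>i j. i \<noteq> j \<Longrightarrow> Q $ i $ j \<le> 0"
    and \<psi>: "\<And>i. 0 < \<psi> $ i" "\<And>i. 0 < (Q *v \<psi>) $ i"
    and x: "\<And>i. 0 \<le> (Q *v x) $ i"
  shows "0 \<le> x $ i"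
proof (rule ccontr)
  assume "\<not> 0 \<le> x $ i"
  define t where "t = Min (range (\<lambda>i. x $ i / \<psi> $ i))"
  have t_le: "t \<le> x $ j / \<psi> $ j" for j
    by (auto simp: t_def intro!: Min_le)
  have "t \<in> range (\<lambda>i. x $ i / \<psi> $ i)"
    unfolding t_def by (rule Min_in) auto
  then obtain k where k: "t = x $ k / \<psi> $ k" by auto
  have "x $ i / \<psi> $ i < 0" using \<open>\<not> 0 \<le> x $ i\<close> \<psi>(1)[of i] by (simp add: field_simps)
  then have "t < 0" using t_le[of i] by linarith
  define w where "w = x - t *s \<psi>"
  have w: "0 \<le> w $ j" for j
    using t_le[of j] \<psi>(1)[of j] by (simp add: w_def field_simps)
  have wk: "w $ k = 0"
    using \<psi>(1)[of k] by (simp add: w_def k)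
  have "Q $ k $ j * w $ j \<le> 0" for j
    using w[of j] wk off[of k j] by (cases "j = k") (auto intro: mult_nonpos_nonneg)
  then have "(Q *v w) $ k \<le> 0"
    by (auto simp: matrix_vector_mult_def intro!: sum_nonpos)
  moreover have "(Q *v w) $ k = (Q *v x) $ k - t * (Q *v \<psi>) $ k"
    by (simp add: w_def matrix_vector_mult_diff_distrib vector_scalar_commute)
  moreover have "t * (Q *v \<psi>) $ k < 0"
    using \<open>t < 0\<close> \<psi>(2)[of k] by (simp add: mult_neg_pos)
  ultimately show False using x[of k] by linarith
qed

lemma M_matrix_invertible:
  fixes Q :: "real ^ 'n ^ 'n"
  assumes off: "\<And>i j. i \<noteq> j \<Longrightarrow> Q $ i $ j \<le> 0"
    and \<psi>: "\<And>i. 0 < \<psi> $ i" "\<And>i. 0 < (Q *v \<psi>) $ i"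
  shows "invertible Q"
proof -
  have "x = 0" if "Q *v x = 0" for x
  proof -
    have "Q *v (- x) = 0"
      using matrix_vector_mult_diff_distrib[of Q 0 x] that by simp
    then have "0 \<le> x $ i" "0 \<le> (- x) $ i" for i
      using M_matrix_nonneg[OF off \<psi>, of x i] M_matrix_nonneg[OF off \<psi>, of "- x" i] that
      by auto
    then show ?thesis by (simp add: vec_eq_iff order_antisym)
  qed
  then show ?thesis
    by (metis invertible_left_inverse matrix_left_invertible_ker)
qed

text \<open>If \<open>x\<close> vanished at \<open>j\<close>, then \<open>(Q x)\<^sub>j\<close> would be a sum of nonpositive terms, the one at \<open>i\<close> being negative.\<close>

lemma M_matrix_pos_step:
  fixes Q :: "real ^ 'n ^ 'n"
  assumes off: "\<And>i j. i \<noteq> j \<Longrightarrow> Q $ i $ j \<le> 0"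
    and x: "\<And>i. 0 \<le> x $ i" "0 \<le> (Q *v x) $ j"
    and i: "i \<noteq> j" "Q $ j $ i < 0" "0 < x $ i"
  shows "0 < x $ j"
proof (rule ccontr)
  assume "\<not> 0 < x $ j"
  then have xj: "x $ j = 0" using x(1)[of j] by simp
  have "(\<Sum>k\<in>UNIV. Q $ j $ k * x $ k) < (\<Sum>k\<in>(UNIV::'n set). 0)"
  proof (rule sum_strict_mono_ex1)
    show "\<forall>k\<in>UNIV. Q $ j $ k * x $ k \<le> 0"
      using xj x(1) off by (metis mult_nonpos_nonneg mult_zero_right order_refl)
    show "\<exists>k\<in>UNIV. Q $ j $ k * x $ k < 0"
      using i by (intro bexI[of _ i]) (auto simp: mult_neg_pos)
  qed simp
  then show False using x(2) by (simp add: matrix_vector_mult_def)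
qed

lemma M_matrix_pos_source:
  fixes Q :: "real ^ 'n ^ 'n"
  assumes off: "\<And>i j. i \<noteq> j \<Longrightarrow> Q $ i $ j \<le> 0"
    and x: "\<And>i. 0 \<le> x $ i" "0 < (Q *v x) $ j"
  shows "0 < x $ j"
proof (rule ccontr)
  assume "\<not> 0 < x $ j"
  then have xj: "x $ j = 0" using x(1)[of j] by simp
  have "(\<Sum>k\<in>UNIV. Q $ j $ k * x $ k) \<le> 0"
    using xj x(1) off by (intro sum_nonpos) (metis mult_nonpos_nonneg mult_zero_right order_refl)
  then show False using x(2) by (simp add: matrix_vector_mult_def)
qed

text \<open>A solution of \<open>x = H x\<close> vanishes at the sinks of \<open>G\<close> and, inductively, everywhere.\<close>

lemma invertible_one_minus_acyclic:
  fixes H :: "'a::field ^ 'v::finite ^ 'v"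
  assumes "acyclic G" and "\<And>v w. (v, w) \<notin> G \<Longrightarrow> H $ v $ w = 0"
  shows "invertible (mat 1 - H)"
proof -
  have wf: "wf (G\<inverse>)"
    using assms(1) by (simp add: finite_acyclic_wf_converse)
  have "x = 0" if "(mat 1 - H) *v x = 0" for x
  proof -
    have eq: "x = H *v x" using that by (simp add: matrix_vector_mult_diff_rdistrib)
    have "x $ v = 0" for v
      using wf
    proof (induction v rule: wf_induct_rule)
      case (less v)
      have "x $ v = (\<Sum>w\<in>UNIV. H $ v $ w * x $ w)"
        by (subst eq) (simp add: matrix_vector_mult_def)
      also have "\<dots> = 0"
        using less assms(2) by (intro sum.neutral) (metis converse_iff mult_zero_left mult_zero_right)
      finally show ?case .
    qed
    then show ?thesis by (simp add: vec_eq_iff)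
  qed
  then show ?thesis
    by (metis invertible_left_inverse matrix_left_invertible_ker)
qed

text \<open>By induction from the sinks, the solution \<open>x = b + H x\<close> is nonnegative, so that \<open>H x\<close> is.\<close>

lemma acyclic_solution_ge:
  fixes H :: "real ^ 'v::finite ^ 'v"
  assumes "acyclic G" and "\<And>v w. (v, w) \<notin> G \<Longrightarrow> H $ v $ w = 0"
    and "\<And>v w. 0 \<le> H $ v $ w" and "\<And>v. 0 \<le> b $ v"
    and "(mat 1 - H) *v x = b"
  shows "b $ v \<le> x $ v"
proof -
  have wf: "wf (G\<inverse>)"
    using assms(1) by (simp add: finite_acyclic_wf_converse)
  have eq: "x $ v = b $ v + (\<Sum>w\<in>UNIV. H $ v $ w * x $ w)" for v
  proof -
    have "((mat 1 - H) *v x) $ v = x $ v - (\<Sum>w\<in>UNIV. H $ v $ w * x $ w)"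
      by (simp add: matrix_vector_mult_diff_rdistrib) (simp add: matrix_vector_mult_def)
    then show ?thesis
      unfolding assms(5) by simp
  qed
  show ?thesis
    using wf
  proof (induction v rule: wf_induct_rule)
    case (less v)
    have "0 \<le> (\<Sum>w\<in>UNIV. H $ v $ w * x $ w)"
    proof (rule sum_nonneg)
      fix w
      show "0 \<le> H $ v $ w * x $ w"
        using less[of w] assms(2)[of v w] assms(3)[of v w] assms(4)[of w]
        by (cases "(v, w) \<in> G") auto
    qed
    then show ?case using eq[of v] by linarith
  qed
qed


section \<open>The linear system of the Bayes ball\<close>

text \<open>Write \<open>\<xi> (Inl v) = a\<^sub>v\<close> and \<open>\<xi> (Inr v) = c\<^sub>v\<close>. The rows \<open>Inl v\<close> are \<open>(P' a)\<^sub>v\<close> for \<open>v \<notin> Z\<close> and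
\<open>- \<omega>\<^sub>v a\<^sub>v - c\<^sub>v\<close> for \<open>v \<in> Z\<close>; the rows \<open>Inr v\<close> are \<open>(P\<^sup>T s)\<^sub>v - \<omega>\<^sub>v a\<^sub>v\<close>, where \<open>s\<close> is \<open>c\<close> cut off to \<open>0\<close> on \<open>Z\<close>
and, for \<open>v \<in> Z\<close>, the term \<open>- \<omega>\<^sub>v a\<^sub>v\<close> is replaced by \<open>c\<^sub>v\<close>. The signs are those of an M-matrix if
\<open>P\<close> and \<open>P'\<close> have nonpositive off-diagonal entries, \<open>\<omega>\<close> is negative on \<open>Z\<close> and nonnegative elsewhere.\<close>

definition ball_matrix ::
  "'v set \<Rightarrow> 'a::field ^ 'v::finite ^ 'v \<Rightarrow> 'a ^ 'v ^ 'v \<Rightarrow> ('v \<Rightarrow> 'a) \<Rightarrow> 'a ^ ('v + 'v) ^ ('v + 'v)" where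
  "ball_matrix Z P P' \<omega> = (\<chi> i j. case i of
     Inl v \<Rightarrow> (case j of
         Inl w \<Rightarrow> if v \<notin> Z then P' $ v $ w else if v = w then - \<omega> v else 0
       | Inr w \<Rightarrow> if v \<in> Z \<and> v = w then - 1 else 0)
   | Inr v \<Rightarrow> (case j of
         Inl w \<Rightarrow> if v \<notin> Z \<and> v = w then - \<omega> v else 0
       | Inr w \<Rightarrow> if w \<notin> Z then P $ w $ v else if v = w then 1 else 0))"

lemma sum_UNIV_Plus:
  fixes f :: "'a::finite + 'b::finite \<Rightarrow> 'c::comm_monoid_add"
  shows "(\<Sum>i\<in>UNIV. f i) = (\<Sum>v\<in>UNIV. f (Inl v)) + (\<Sum>v\<in>UNIV. f (Inr v))"
  using sum.Plus[of "UNIV :: 'a set" "UNIV :: 'b set" f] by (simp add: UNIV_Plus_UNIV)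

lemma ball_matrix_mult_Inl:
  "(ball_matrix Z P P' \<omega> *v x) $ Inl v =
     (if v \<in> Z then - \<omega> v * x $ Inl v - x $ Inr v else \<Sum>w\<in>UNIV. P' $ v $ w * x $ Inl w)"
proof (cases "v \<in> Z")
  case True
  have *: "(if v = w then a else 0) * (b::'a) = (if v = w then a * b else 0)" for w a b by simp
  show ?thesis using True
    by (simp add: ball_matrix_def matrix_vector_mult_def sum_UNIV_Plus * sum.delta sum_negf)
next
  case False
  then show ?thesis
    by (simp add: ball_matrix_def matrix_vector_mult_def sum_UNIV_Plus)
qed

lemma ball_matrix_mult_Inr:
  "(ball_matrix Z P P' \<omega> *v x) $ Inr v =
     (if v \<in> Z then x $ Inr v else - \<omega> v * x $ Inl v) + (\<Sum>w\<in>- Z. P $ w $ v * x $ Inr w)"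
proof -
  have *: "(if v = w then a else 0) * (b::'a) = (if v = w then a * b else 0)" for w a b by simp
  have "(\<Sum>w\<in>UNIV. (if w \<notin> Z then P $ w $ v else if v = w then 1 else 0) * x $ Inr w) =
      (\<Sum>w\<in>- Z. P $ w $ v * x $ Inr w) + (\<Sum>w\<in>Z. (if v = w then 1 else 0) * x $ Inr w)"
    using sum.Int_Diff[of UNIV "\<lambda>w. (if w \<notin> Z then P $ w $ v else if v = w then 1 else 0) * x $ Inr w" "- Z"]
    by (simp add: Compl_eq_Diff_UNIV[symmetric] Diff_Diff_Int)
  also have "(\<Sum>w\<in>Z. (if v = w then 1 else 0) * x $ Inr w) = (if v \<in> Z then x $ Inr v else 0)"
    by (simp only: * sum.delta' finite mult_1)
  finally show ?thesis
    by (simp add: ball_matrix_def matrix_vector_mult_def sum_UNIV_Plus *)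
qed

text \<open>On \<open>Z\<close> the vector \<open>S u\<close> vanishes, so its slot is free; it stores the value \<open>- \<omega>\<^sub>v a\<^sub>v\<close>, which the
equations \<open>P\<^sup>T (S u) = diag \<omega> a\<close> force upon the sum of \<open>- P\<^sub>w\<^sub>,\<^sub>v (S u)\<^sub>w\<close> over \<open>w \<notin> Z\<close>.\<close>

lemma ball_system:
  fixes S P P' :: "'a::field ^ 'v::finite ^ 'v"
  assumes S: "transpose P ** S ** P' = (\<chi> v w. if v = w then \<omega> v else 0)"
    and a: "P' *v a = u" and Z: "\<And>z. z \<in> Z \<Longrightarrow> (S *v u) $ z = 0"
  defines "x \<equiv> \<chi> i. case i of Inl v \<Rightarrow> a $ v | Inr v \<Rightarrow> if v \<in> Z then - \<omega> v * a $ v else (S *v u) $ v"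
  shows "ball_matrix Z P P' \<omega> *v x = (\<chi> i. case i of Inl v \<Rightarrow> if v \<in> Z then 0 else u $ v | Inr v \<Rightarrow> 0)"
proof -
  have "transpose P *v (S *v u) = (\<chi> v w. if v = w then \<omega> v else 0) *v a"
    unfolding a[symmetric] S[symmetric] by (simp add: matrix_vector_mul_assoc matrix_mul_assoc)
  then have "(transpose P *v (S *v u)) $ v = \<omega> v * a $ v" for v
    by (simp add: matrix_vector_mult_def if_distrib[of "\<lambda>x. x * _"] cong: if_cong)
  then have s: "(\<Sum>w\<in>UNIV. P $ w $ v * (S *v u) $ w) = \<omega> v * a $ v" for v
    by (simp add: matrix_vector_mult_def transpose_def)
  have "(\<Sum>w\<in>- Z. P $ w $ v * x $ Inr w) = (\<Sum>w\<in>UNIV. P $ w $ v * (S *v u) $ w)" for v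
    by (rule sum.mono_neutral_cong_left) (auto simp: x_def Z)
  then have "(\<Sum>w\<in>- Z. P $ w $ v * x $ Inr w) = \<omega> v * a $ v" for v
    by (simp add: s)
  then have Inr: "(ball_matrix Z P P' \<omega> *v x) $ Inr v = 0" for v
    by (simp add: ball_matrix_mult_Inr) (simp add: x_def)
  have "(\<Sum>w\<in>UNIV. P' $ v $ w * x $ Inl w) = u $ v" for v
    unfolding a[symmetric] by (simp add: matrix_vector_mult_def x_def)
  then have Inl: "(ball_matrix Z P P' \<omega> *v x) $ Inl v = (if v \<in> Z then 0 else u $ v)" for v
    by (simp add: ball_matrix_mult_Inl) (simp add: x_def)
  show ?thesis
    using Inl Inr by (auto simp: vec_eq_iff split: sum.split)
qed

lemma block_mult_block:
  "block X Z A ** block Z Y B = (\<chi> i j. if i \<in> X \<and> j \<in> Y then \<Sum>k\<in>Z. A $ i $ k * B $ k $ j else 0)"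
proof -
  have "(\<Sum>k\<in>UNIV. (if i \<in> X \<and> k \<in> Z then A $ i $ k else 0) * (if k \<in> Z \<and> j \<in> Y then B $ k $ j else 0)) =
      (if i \<in> X \<and> j \<in> Y then \<Sum>k\<in>Z. A $ i $ k * B $ k $ j else 0)" for i j
    by (cases "i \<in> X \<and> j \<in> Y")
       (auto intro!: sum.mono_neutral_cong_right sum.neutral)
  then show ?thesis
    by (simp add: block_def matrix_matrix_mult_def)
qed

text \<open>The block of \<open>M\<close> with rows and columns in \<open>Z\<close> has trivial kernel.\<close>

definition nonsingular_on :: "'v set \<Rightarrow> 'a::field ^ 'v::finite ^ 'v \<Rightarrow> bool" where
  "nonsingular_on Z M \<longleftrightarrow> (\<forall>u. (\<forall>i. i \<notin> Z \<longrightarrow> u $ i = 0) \<and> (\<forall>i\<in>Z. (M *v u) $ i = 0) \<longrightarrow> u = 0)"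

text \<open>Completing the block by the identity outside \<open>Z\<close> gives an invertible matrix, whose inverse has the
required block.\<close>

lemma block_inv_nonsingular:
  fixes M :: "'a::field ^ 'v::finite ^ 'v"
  assumes "nonsingular_on Z M"
  shows "block Z Z (block_inv Z M) = block_inv Z M"
    and "block Z Z M ** block_inv Z M = block Z Z (mat 1)"
proof -
  define K where "K = (\<chi> i j. if i \<in> Z \<and> j \<in> Z then M $ i $ j else if i = j then 1 else 0)"
  have "u = 0" if Ku: "K *v u = 0" for u
  proof (rule assms[unfolded nonsingular_on_def, rule_format, OF conjI])
    have K0: "(\<Sum>j\<in>UNIV. K $ i $ j * u $ j) = 0" for i
      using arg_cong[OF Ku, of "\<lambda>y. y $ i"] by (simp only: matrix_vector_mult_def vec_lambda_beta zero_index)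
    have out: "u $ i = 0" if "i \<notin> Z" for i
      using K0[of i] that
      by (simp add: K_def if_distrib[of "\<lambda>x. x * _"] cong: if_cong)
    then show "\<forall>i. i \<notin> Z \<longrightarrow> u $ i = 0" by blast
    show "\<forall>i\<in>Z. (M *v u) $ i = 0"
    proof
      fix i assume i: "i \<in> Z"
      have *: "K $ i $ j * u $ j = M $ i $ j * u $ j" for j
        using i out[of j] by (cases "j \<in> Z") (auto simp: K_def)
      show "(M *v u) $ i = 0" using K0[of i] by (simp only: * matrix_vector_mult_def vec_lambda_beta)
    qed
  qed
  then have "invertible K"
    by (metis invertible_left_inverse matrix_left_invertible_ker)
  then have inv: "K ** matrix_inv K = mat 1" "matrix_inv K ** K = mat 1"
    by (simp_all add: matrix_inv_inverse)
  have KZ: "(\<Sum>k\<in>Z. M $ i $ k * matrix_inv K $ k $ j) = (K ** matrix_inv K) $ i $ j" if "i \<in> Z" for i j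
    unfolding matrix_matrix_mult_def
    using that by (auto simp: K_def intro!: sum.mono_neutral_cong_left)
  have ZK: "(\<Sum>k\<in>Z. matrix_inv K $ i $ k * M $ k $ j) = (matrix_inv K ** K) $ i $ j" if "j \<in> Z" for i j
    unfolding matrix_matrix_mult_def
    using that by (auto simp: K_def intro!: sum.mono_neutral_cong_left)
  have "block Z Z (block Z Z (matrix_inv K)) = block Z Z (matrix_inv K)"
    by (simp add: block_def vec_eq_iff)
  moreover have "block Z Z M ** block Z Z (matrix_inv K) = block Z Z (mat 1)"
    unfolding block_mult_block using inv(1) by (auto simp: vec_eq_iff KZ block_def)
  moreover have "block Z Z (matrix_inv K) ** block Z Z M = block Z Z (mat 1)"
    unfolding block_mult_block using inv(2) by (auto simp: vec_eq_iff ZK block_def)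
  ultimately have "\<exists>N. block Z Z N = N \<and> block Z Z M ** N = block Z Z (mat 1) \<and>
      N ** block Z Z M = block Z Z (mat 1)"
    by blast
  then show "block Z Z (block_inv Z M) = block_inv Z M"
    "block Z Z M ** block_inv Z M = block Z Z (mat 1)"
    unfolding block_inv_def by (rule someI2_ex, blast)+
qed

text \<open>The vector \<open>u\<close> represents the residual of \<open>y\<close> after linear regression on \<open>Z\<close>: it is \<open>e\<^sub>y\<close> minus the
regression coefficients, so it is orthogonal to \<open>Z\<close> with respect to \<open>S\<close>, and its covariance with \<open>x\<close> is
the Schur complement.\<close>

lemma cond_spectrum_regression:
  fixes S :: "ratfun ^ 'v::finite ^ 'v"
  assumes ns: "nonsingular_on Z S"
    and xy: "x \<in> X" "y \<in> Y" "y \<notin> Z"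
  obtains u where "u $ y = 1" "\<And>i. i \<notin> Z \<Longrightarrow> i \<noteq> y \<Longrightarrow> u $ i = 0"
    "\<And>i. i \<in> Z \<Longrightarrow> (S *v u) $ i = 0" "cond_spectrum S X Y Z $ x $ y = (S *v u) $ x"
proof
  note inv = block_inv_nonsingular[OF ns]
  define N where "N = block_inv Z S ** block Z Y S"
  have "N = block Z Z (block_inv Z S) ** block Z Y S"
    by (simp add: N_def inv(1))
  then have N: "N = block Z Y N"
    by (simp add: block_mult_block) (simp add: block_def vec_eq_iff)
  define u where "u = (\<chi> i. (if i = y then 1 else 0) - N $ i $ y)"
  have N0: "N $ i $ y = 0" if "i \<notin> Z" for i
    using that by (subst N) (simp add: block_def)
  show "u $ y = 1" "\<And>i. i \<notin> Z \<Longrightarrow> i \<noteq> y \<Longrightarrow> u $ i = 0"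
    using N0 xy by (auto simp: u_def)
  have Su: "(S *v u) $ i = S $ i $ y - (\<Sum>k\<in>Z. S $ i $ k * N $ k $ y)" for i
  proof -
    have "(\<Sum>k\<in>UNIV. S $ i $ k * N $ k $ y) = (\<Sum>k\<in>Z. S $ i $ k * N $ k $ y)"
      by (rule sum.mono_neutral_right) (auto simp: N0)
    then show ?thesis
      by (simp add: matrix_vector_mult_def u_def right_diff_distrib sum_subtractf
          if_distrib[of "\<lambda>x. _ * x"] cong: if_cong)
  qed
  have "block Z Z S ** N = block Z Z (mat 1) ** block Z Y S"
    by (simp add: N_def matrix_mul_assoc inv(2))
  also have "\<dots> = block Z Y S"
    unfolding block_mult_block
    by (auto simp: vec_eq_iff block_def mat_def if_distrib[of "\<lambda>x. x * _"] cong: if_cong)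
  finally have "block Z Z S ** block Z Y N = block Z Y S"
    using N by simp
  then have eq: "(block Z Z S ** block Z Y N) $ i $ y = block Z Y S $ i $ y" for i
    by simp
  show "(S *v u) $ i = 0" if "i \<in> Z" for i
    using eq[of i] that xy unfolding Su block_mult_block by (simp add: block_def)
  have "cond_spectrum S X Y Z = block X Y S - block X Z S ** N"
    by (simp add: cond_spectrum_def N_def matrix_mul_assoc)
  also have "\<dots> = block X Y S - block X Z S ** block Z Y N"
    using N by simp
  finally show "cond_spectrum S X Y Z $ x $ y = (S *v u) $ x"
    using xy unfolding Su block_mult_block by (simp add: block_def)
qed

text \<open>Invertibility of \<open>Q\<close> also shows that the block of \<open>S\<close> on \<open>Z\<close> is nonsingular: a kernel vector supported
on \<open>Z\<close> solves the homogeneous ball system.\<close>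

theorem cond_spectrum_ball_system:
  fixes S P P' :: "ratfun ^ 'v::finite ^ 'v"
  assumes S: "transpose P ** S ** P' = (\<chi> v w. if v = w then \<omega> v else 0)"
    and P': "invertible P'" and Q: "invertible (ball_matrix Z P P' \<omega>)"
    and xy: "x \<in> X" "y \<in> Y" "x \<notin> Z" "y \<notin> Z"
    and \<xi>: "ball_matrix Z P P' \<omega> *v \<xi> = axis (Inl y) 1"
  shows "cond_spectrum S X Y Z $ x $ y = \<xi> $ Inr x"
proof -
  have P'P: "P' *v (matrix_inv P' *v u) = u" for u
    using P' by (simp add: matrix_vector_mul_assoc matrix_inv_inverse)
  have Qinj: "v = w" if "ball_matrix Z P P' \<omega> *v v = ball_matrix Z P P' \<omega> *v w" for v w
    using that Q by (metis injD invertible_left_inverse matrix_left_invertible_injective)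
  note sys = ball_system[OF S P'P]
  have "nonsingular_on Z S"
    unfolding nonsingular_on_def
  proof (intro allI impI; elim conjE)
    fix u
    assume Z: "\<forall>i. i \<notin> Z \<longrightarrow> u $ i = 0" "\<forall>i\<in>Z. (S *v u) $ i = 0"
    then have u: "\<And>i. i \<notin> Z \<Longrightarrow> u $ i = 0" "\<And>i. i \<in> Z \<Longrightarrow> (S *v u) $ i = 0" by auto
    have "(\<chi> i. case i of Inl v \<Rightarrow> if v \<in> Z then 0 else u $ v | Inr v \<Rightarrow> 0) = (0 :: ratfun ^ ('v + 'v))"
      using u(1) by (auto simp: vec_eq_iff split: sum.split)
    with sys[OF u(2)]
    have "ball_matrix Z P P' \<omega> *v (\<chi> i. case i of Inl v \<Rightarrow> (matrix_inv P' *v u) $ v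
        | Inr v \<Rightarrow> if v \<in> Z then - \<omega> v * (matrix_inv P' *v u) $ v else (S *v u) $ v) =
      ball_matrix Z P P' \<omega> *v 0" by simp
    from Qinj[OF this] have "(matrix_inv P' *v u) $ v = 0" for v
      by (auto simp: vec_eq_iff dest: spec[of _ "Inl v"])
    then have "matrix_inv P' *v u = 0" by (simp add: vec_eq_iff)
    then show "u = 0" using P'P[of u] by simp
  qed
  from cond_spectrum_regression[OF this xy(1,2,4)] obtain u where
    u: "u $ y = 1" "\<And>i. i \<notin> Z \<Longrightarrow> i \<noteq> y \<Longrightarrow> u $ i = 0"
    "\<And>i. i \<in> Z \<Longrightarrow> (S *v u) $ i = 0" "cond_spectrum S X Y Z $ x $ y = (S *v u) $ x" by blast
  have "(\<chi> i. case i of Inl v \<Rightarrow> if v \<in> Z then 0 else u $ v | Inr v \<Rightarrow> 0) =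
      (axis (Inl y) 1 :: ratfun ^ ('v + 'v))"
    using u(1,2) xy(4) by (auto simp: vec_eq_iff axis_def split: sum.split)
  with sys[OF u(3)] \<xi>
  have "ball_matrix Z P P' \<omega> *v (\<chi> i. case i of Inl v \<Rightarrow> (matrix_inv P' *v u) $ v
      | Inr v \<Rightarrow> if v \<in> Z then - \<omega> v * (matrix_inv P' *v u) $ v else (S *v u) $ v) =
    ball_matrix Z P P' \<omega> *v \<xi>" by simp
  from arg_cong[OF Qinj[OF this], of "\<lambda>\<xi>. \<xi> $ Inr x"] show ?thesis
    using u(4) xy(3) by simp
qed

text \<open>A nonzero off-diagonal coefficient in row \<open>i\<close> and column \<open>j\<close> is a move from \<open>j\<close> to \<open>i\<close>, so the rows of
unreached states vanish at the reached ones.\<close>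

lemma ball_matrix_soundness:
  fixes P P' :: "'a::field ^ 'v::finite ^ 'v"
  assumes Q: "invertible (ball_matrix Z P P' \<omega>)"
    and P: "\<And>v w. v \<noteq> w \<Longrightarrow> (v, w) \<notin> G \<Longrightarrow> P $ v $ w = 0"
    and P': "\<And>v w. v \<noteq> w \<Longrightarrow> (v, w) \<notin> G \<Longrightarrow> P' $ v $ w = 0"
    and \<xi>: "ball_matrix Z P P' \<omega> *v \<xi> = axis (Inl y) 1"
    and t: "\<not> bayes_ball G Z y t"
  shows "\<xi> $ t = 0"
proof (rule inverse_preserves_coordinate_subspace[OF Q])
  show "t \<in> {t. \<not> bayes_ball G Z y t}" using t by simp
  show "(ball_matrix Z P P' \<omega> *v \<xi>) $ i = 0" if "i \<in> {t. \<not> bayes_ball G Z y t}" for i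
    using that bayes_ball.source[of G Z y] by (auto simp: \<xi> axis_def)
  have up: "P' $ v $ w = 0"
    if "\<not> bayes_ball G Z y (Inl v)" "bayes_ball G Z y (Inl w)" "v \<notin> Z" for v w
    using P'[of v w] bayes_ball.up that by metis
  have down: "P $ w $ v = 0"
    if "\<not> bayes_ball G Z y (Inr v)" "bayes_ball G Z y (Inr w)" "w \<notin> Z" for v w
    using P[of w v] bayes_ball.down that by metis
  show "ball_matrix Z P P' \<omega> $ i $ j = 0"
    if "i \<in> {t. \<not> bayes_ball G Z y t}" "j \<notin> {t. \<not> bayes_ball G Z y t}" for i j
    using that
    by (auto simp: ball_matrix_def up down split: sum.split if_splits
        intro: bayes_ball.turn_up bayes_ball.turn_down)
qed


section \<open>Factorization of the spectrum and evaluation at one\<close>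

text \<open>Evaluation at \<open>z = 1\<close>, as a relation since it is undefined at a pole. At this point the involution
\<open>r(z) \<mapsto> r(z\<^sup>-\<^sup>1)\<close> acts trivially, and a nonzero value shows that a rational function is nonzero.\<close>

definition value_at_one :: "ratfun \<Rightarrow> real \<Rightarrow> bool" where
  "value_at_one r c \<longleftrightarrow> (\<exists>p q. r = Fract p q \<and> poly q 1 \<noteq> 0 \<and> poly p 1 = c * poly q 1)"

lemma value_at_one_Fract:
  "poly q 1 \<noteq> 0 \<Longrightarrow> value_at_one (Fract p q) (poly p 1 / poly q 1)"
  unfolding value_at_one_def by (intro exI[of _ p] exI[of _ q]) simp

lemma value_at_one_to_fract: "value_at_one (to_fract p) (poly p 1)"
  using value_at_one_Fract[of 1 p] by (simp add: to_fract_def)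

lemma value_at_one_0: "value_at_one 0 0"
  using value_at_one_to_fract[of 0] by simp

lemma value_at_one_1: "value_at_one 1 1"
  using value_at_one_to_fract[of 1] by simp

lemma value_at_one_const: "value_at_one (rf_const c) c"
  using value_at_one_to_fract[of "[:c:]"] by (simp add: rf_const_def)

lemma value_at_one_add:
  assumes "value_at_one r c" "value_at_one s d"
  shows "value_at_one (r + s) (c + d)"
proof -
  obtain p q p' q' where r: "r = Fract p q" "poly q 1 \<noteq> 0" "poly p 1 = c * poly q 1"
    and s: "s = Fract p' q'" "poly q' 1 \<noteq> 0" "poly p' 1 = d * poly q' 1"
    using assms by (auto simp: value_at_one_def)
  then have "q \<noteq> 0" "q' \<noteq> 0" by auto
  then show ?thesis
    unfolding value_at_one_def using r s
    by (intro exI[of _ "p * q' + p' * q"] exI[of _ "q * q'"]) (auto simp: algebra_simps)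
qed

lemma value_at_one_mult:
  assumes "value_at_one r c" "value_at_one s d"
  shows "value_at_one (r * s) (c * d)"
proof -
  obtain p q p' q' where r: "r = Fract p q" "poly q 1 \<noteq> 0" "poly p 1 = c * poly q 1"
    and s: "s = Fract p' q'" "poly q' 1 \<noteq> 0" "poly p' 1 = d * poly q' 1"
    using assms by (auto simp: value_at_one_def)
  then show ?thesis
    unfolding value_at_one_def
    by (intro exI[of _ "p * p'"] exI[of _ "q * q'"]) auto
qed

lemma value_at_one_uminus: "value_at_one r c \<Longrightarrow> value_at_one (- r) (- c)"
  using value_at_one_mult[OF value_at_one_to_fract[of "- 1"], of r c] by simp

lemma value_at_one_diff: "value_at_one r c \<Longrightarrow> value_at_one s d \<Longrightarrow> value_at_one (r - s) (c - d)"
  using value_at_one_add[of r c "- s" "- d"] value_at_one_uminus by simp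

lemma value_at_one_sum:
  "(\<And>i. i \<in> A \<Longrightarrow> value_at_one (f i) (g i)) \<Longrightarrow> value_at_one (sum f A) (sum g A)"
  by (induction A rule: infinite_finite_induct) (auto intro: value_at_one_0 value_at_one_add)

lemma value_at_one_prod:
  "(\<And>i. i \<in> A \<Longrightarrow> value_at_one (f i) (g i)) \<Longrightarrow> value_at_one (prod f A) (prod g A)"
  by (induction A rule: infinite_finite_induct) (auto intro: value_at_one_1 value_at_one_mult)

lemma value_at_one_det:
  assumes "\<And>i j. value_at_one (A $ i $ j) (B $ i $ j)"
  shows "value_at_one (det A) (det B)"
proof -
  have "value_at_one (of_int (sign p)) (of_int (sign p))" for p :: "'n \<Rightarrow> 'n"
    using value_at_one_1 value_at_one_uminus[OF value_at_one_1] by (simp add: sign_def)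
  then show ?thesis
    unfolding det_def by (intro value_at_one_sum value_at_one_mult value_at_one_prod assms)
qed

lemma value_at_one_nonzero:
  assumes "value_at_one r c" "c \<noteq> 0"
  shows "r \<noteq> 0"
proof -
  obtain p q where r: "r = Fract p q" "poly q 1 \<noteq> 0" "poly p 1 = c * poly q 1"
    using assms(1) by (auto simp: value_at_one_def)
  then have "p \<noteq> 0" "q \<noteq> 0"
    using assms(2) by auto
  then show ?thesis
    by (simp add: r(1) Zero_fract_def eq_fract)
qed

lemma value_at_one_poly_at_inverse: "value_at_one (poly_at_inverse p) (poly p 1)"
proof (induction p)
  case 0
  then show ?case by (simp add: value_at_one_0)
next
  case (pCons a p)
  have "value_at_one (inverse rf_z) 1"
    unfolding value_at_one_def
    by (intro exI[of _ 1] exI[of _ "[:0, 1:]"]) (simp add: rf_z_def to_fract_def)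
  from value_at_one_add[OF value_at_one_const[of a] value_at_one_mult[OF this pCons.IH]]
  show ?case by (simp add: poly_at_inverse_pCons)
qed

lemma poly_at_inverse_1 [simp]: "poly_at_inverse 1 = 1"
  using poly_at_inverse_pCons[of 1 0] by (simp add: rf_const_def flip: one_pCons)

lemma poly_at_inverse_diff: "poly_at_inverse (p - q) = poly_at_inverse p - poly_at_inverse q"
  using poly_at_inverse_add[of "p - q" q] by (simp add: algebra_simps)

lemma rf_star_to_fract: "rf_star (to_fract p) = poly_at_inverse p"
  using rf_star_Fract[of 1 p] by (simp add: to_fract_def)

lemma rf_star_divide:
  assumes "q \<noteq> 0"
  shows "rf_star (to_fract p / to_fract q) = poly_at_inverse p / poly_at_inverse q"
proof -
  have "to_fract p / to_fract q = Fract p q"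
    by (simp add: to_fract_def)
  then show ?thesis by (simp add: rf_star_Fract[OF assms])
qed

lemma finite_lagged_edges:
  fixes \<G> :: "'v::finite tsgraph"
  assumes "ts_graph \<G>"
  shows "finite (lagged_edges \<G>)"
proof (rule finite_subset)
  show "lagged_edges \<G> \<subseteq> UNIV \<times> UNIV \<times> {k. \<exists>v w. (v, w, k) \<in> lagged_edges \<G>}" by auto
  show "finite (UNIV \<times> UNIV \<times> {k. \<exists>v w. (v, w, k) \<in> lagged_edges \<G>} :: ('v \<times> 'v \<times> nat) set)"
    using assms by (simp add: ts_graph_def)
qed

definition lag_sum :: "'v tsgraph \<Rightarrow> 'v coeffs \<Rightarrow> 'v \<Rightarrow> 'v \<Rightarrow> real" where
  "lag_sum \<G> \<Phi> v w = (\<Sum>k | (v, w, k) \<in> lagged_edges \<G>. \<Phi> (v, w, k))"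

lemma value_at_one_lag_poly:
  "value_at_one (lag_poly \<G> \<Phi> v w) (lag_sum \<G> \<Phi> v w)"
  "value_at_one (rf_star (lag_poly \<G> \<Phi> v w)) (lag_sum \<G> \<Phi> v w)"
proof -
  have "lag_sum \<G> \<Phi> v w = poly (\<Sum>k | (v, w, k) \<in> lagged_edges \<G>. monom (\<Phi> (v, w, k)) k) 1"
    by (simp add: lag_sum_def poly_sum poly_monom)
  then show "value_at_one (lag_poly \<G> \<Phi> v w) (lag_sum \<G> \<Phi> v w)"
    "value_at_one (rf_star (lag_poly \<G> \<Phi> v w)) (lag_sum \<G> \<Phi> v w)"
    unfolding lag_poly_def rf_star_to_fract
    by (simp_all only: value_at_one_to_fract value_at_one_poly_at_inverse)
qed

lemma lag_poly_eq_0: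
  assumes "v \<noteq> w" "(v, w) \<notin> process_graph \<G>"
  shows "lag_poly \<G> \<Phi> v w = 0"
proof -
  have "{k. (v, w, k) \<in> lagged_edges \<G>} = {}"
    using assms by (auto simp: process_graph_def)
  then show ?thesis by (simp add: lag_poly_def)
qed

lemma lag_poly_neq_1:
  assumes "(\<Phi>, \<Omega>) \<in> param_stb \<G>"
  shows "lag_poly \<G> \<Phi> v v \<noteq> 1"
proof -
  have "\<bar>lag_sum \<G> \<Phi> v v\<bar> \<le> (\<Sum>k | (v, v, k) \<in> lagged_edges \<G>. \<bar>\<Phi> (v, v, k)\<bar>)"
    unfolding lag_sum_def by (rule sum_abs)
  also have "\<dots> < 1"
    using assms by (auto simp: param_stb_def)
  finally have "lag_sum \<G> \<Phi> v v - 1 \<noteq> 0" by auto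
  then have "lag_poly \<G> \<Phi> v v - 1 \<noteq> 0"
    by (rule value_at_one_nonzero[OF value_at_one_diff[OF value_at_one_lag_poly(1) value_at_one_1]])
  then show ?thesis by simp
qed

text \<open>The argument \<open>f\<close> is the identity for \<open>I - \<phi>\<close> and the involution for \<open>I - \<phi>\<^sup>*\<close>.\<close>

definition lag_matrix :: "(ratfun \<Rightarrow> ratfun) \<Rightarrow> 'v tsgraph \<Rightarrow> 'v::finite coeffs \<Rightarrow> ratfun ^ 'v ^ 'v" where
  "lag_matrix f \<G> \<Phi> = (\<chi> v w. (if v = w then 1 else 0) - f (lag_poly \<G> \<Phi> v w))"

lemma mult_diagonal_right:
  fixes A :: "'a::semiring_1 ^ 'v::finite ^ 'v"
  shows "A ** (\<chi> v w. if v = w then d v else 0) = (\<chi> v w. A $ v $ w * d w)"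
  by (simp add: matrix_matrix_mult_def if_distrib[of "\<lambda>x. _ * x"] cong: if_cong)

lemma mult_diagonal_left:
  fixes A :: "'a::semiring_1 ^ 'v::finite ^ 'v"
  shows "(\<chi> v w. if v = w then d v else 0) ** A = (\<chi> v w. d v * A $ v $ w)"
  by (simp add: matrix_matrix_mult_def if_distrib[of "\<lambda>x. x * _"] cong: if_cong)

lemma invertible_diagonal:
  fixes d :: "'v::finite \<Rightarrow> 'a::field"
  assumes "\<And>v. d v \<noteq> 0"
  shows "invertible (\<chi> v w. if v = w then d v else 0)"
  unfolding invertible_def
  by (rule exI[of _ "\<chi> v w. if v = w then inverse (d v) else 0"])
     (simp add: mult_diagonal_left assms mat_def vec_eq_iff)

text \<open>Multiplying the columns of \<open>I - H\<close> by \<open>1 - \<phi>\<^sub>w\<^sub>,\<^sub>w\<close> gives \<open>I - \<phi>\<close>, and the same factors cancel the auto-lag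
terms of the internal spectrum. This leaves no denominators, so that the parameters enter the ball matrix
polynomially.\<close>

theorem spectrum_factorization:
  fixes \<G> :: "'v::finite tsgraph"
  assumes "acyclic (process_graph \<G>)" and "\<And>v. lag_poly \<G> \<Phi> v v \<noteq> 1"
  shows "invertible (lag_matrix rf_star \<G> \<Phi>)" (is "invertible ?P'")
    and "transpose (lag_matrix id \<G> \<Phi>) ** spectrum \<G> \<Phi> \<Omega> ** lag_matrix rf_star \<G> \<Phi> =
      (\<chi> v w. if v = w then rf_const (\<Omega> v) else 0)"
proof -
  define p where "p v w = (\<Sum>k | (v, w, k) \<in> lagged_edges \<G>. monom (\<Phi> (v, w, k)) k)" for v w
  have lag: "lag_poly \<G> \<Phi> v w = to_fract (p v w)" for v w
    by (simp add: lag_poly_def p_def)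
  have p1: "1 - p v v \<noteq> 0" for v
    using assms(2)[of v] by (auto simp: lag)
  have lag1: "1 - lag_poly \<G> \<Phi> v v = to_fract (1 - p v v)" for v
    by (simp add: lag)
  have star: "rf_star (lag_poly \<G> \<Phi> v w / (1 - lag_poly \<G> \<Phi> w w)) =
      poly_at_inverse (p v w) / (1 - poly_at_inverse (p w w))" for v w
    unfolding lag1 unfolding lag by (simp only: rf_star_divide[OF p1] poly_at_inverse_diff poly_at_inverse_1)
  have star_inv: "rf_star (inverse (1 - lag_poly \<G> \<Phi> v v)) = inverse (1 - poly_at_inverse (p v v))" for v
    unfolding lag1 using rf_star_divide[OF p1[of v], of 1]
    by (simp only: poly_at_inverse_diff poly_at_inverse_1 to_fract_1 inverse_eq_divide)
  have pai1: "1 - poly_at_inverse (p v v) \<noteq> 0" for v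
    using poly_at_inverse_eq_0_iff[of "1 - p v v"] p1[of v] unfolding poly_at_inverse_diff by simp
  have tf1: "1 - to_fract (p v v) \<noteq> 0" for v
    using assms(2)[of v] by (simp add: lag)
  have irr: "(v, v) \<notin> process_graph \<G>" for v
    by (simp add: process_graph_def)
  have off: "to_fract (p v w) = 0" "poly_at_inverse (p v w) = 0" if "v \<noteq> w" "(v, w) \<notin> process_graph \<G>" for v w
    using lag_poly_eq_0[OF that, of \<Phi>] by (auto simp: lag)
  define A where "A = mat 1 - transfer_function \<G> \<Phi>"
  define A' where "A' = mat 1 - map_matrix rf_star (transfer_function \<G> \<Phi>)"
  define \<Delta> where "\<Delta> = (\<chi> v w. if v = w then 1 - to_fract (p v v) else (0 :: ratfun))"
  define \<Delta>' where "\<Delta>' = (\<chi> v w. if v = w then 1 - poly_at_inverse (p v v) else (0 :: ratfun))"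
  have P: "lag_matrix id \<G> \<Phi> = A ** \<Delta>"
    unfolding \<Delta>_def mult_diagonal_right
    using tf1 irr off by (auto simp: vec_eq_iff lag_matrix_def A_def transfer_function_def mat_def lag)
  have P': "lag_matrix rf_star \<G> \<Phi> = A' ** \<Delta>'"
    unfolding \<Delta>'_def mult_diagonal_right
    using pai1 irr off rf_star_to_fract[of 0]
    by (auto simp: vec_eq_iff lag_matrix_def A'_def transfer_function_def mat_def star)
       (simp_all add: lag rf_star_to_fract)
  have A: "invertible A"
    unfolding A_def
    by (rule invertible_one_minus_acyclic[OF assms(1)]) (simp add: transfer_function_def)
  have A': "invertible A'"
    unfolding A'_def
    by (rule invertible_one_minus_acyclic[OF assms(1)])
       (use rf_star_to_fract[of 0] in \<open>simp add: transfer_function_def\<close>)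
  have "invertible \<Delta>'"
    unfolding \<Delta>'_def by (rule invertible_diagonal) (rule pai1)
  then show "invertible ?P'"
    unfolding P' using A' by (rule invertible_mult[rotated])
  have "transpose A ** transpose (matrix_inv A) = mat 1"
    using matrix_inv_inverse(2)[OF A] by (metis matrix_transpose_mul transpose_mat)
  then have "transpose (A ** \<Delta>) ** (transpose (matrix_inv A) ** internal_spectrum \<G> \<Phi> \<Omega> ** matrix_inv A') ** (A' ** \<Delta>') =
      transpose \<Delta> ** internal_spectrum \<G> \<Phi> \<Omega> ** \<Delta>'"
    using matrix_inv_inverse(2)[OF A']
    by (metis (no_types, lifting) matrix_mul_assoc matrix_mul_lid matrix_mul_rid matrix_transpose_mul)
  also have "\<dots> = (\<chi> v w. if v = w then rf_const (\<Omega> v) else 0)"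
  proof -
    have sym: "transpose \<Delta> = \<Delta>"
      by (auto simp: \<Delta>_def transpose_def vec_eq_iff)
    show ?thesis
      unfolding sym
      unfolding \<Delta>'_def mult_diagonal_right
      unfolding \<Delta>_def mult_diagonal_left
      using tf1 pai1 by (auto simp: vec_eq_iff internal_spectrum_def star_inv[unfolded lag] lag)
  qed
  finally show "transpose (lag_matrix id \<G> \<Phi>) ** spectrum \<G> \<Phi> \<Omega> ** lag_matrix rf_star \<G> \<Phi> =
      (\<chi> v w. if v = w then rf_const (\<Omega> v) else 0)"
    unfolding P P' spectrum_def A_def[symmetric] A'_def[symmetric] .
qed


section \<open>Polynomial functions vanish on null sets\<close>

text \<open>The parameter space is
a product of function spaces and not a normed space, hence the coordinate functions \<open>C\<close> are given
explicitly.\<close>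

inductive polynomial_in :: "('a \<Rightarrow> real) set \<Rightarrow> ('a \<Rightarrow> real) \<Rightarrow> bool" for C where
  coordinate: "f \<in> C \<Longrightarrow> polynomial_in C f"
| const: "polynomial_in C (\<lambda>_. c)"
| add: "polynomial_in C f \<Longrightarrow> polynomial_in C g \<Longrightarrow> polynomial_in C (\<lambda>x. f x + g x)"
| mult: "polynomial_in C f \<Longrightarrow> polynomial_in C g \<Longrightarrow> polynomial_in C (\<lambda>x. f x * g x)"

lemma polynomial_in_uminus: "polynomial_in C f \<Longrightarrow> polynomial_in C (\<lambda>x. - f x)"
  using polynomial_in.mult[OF polynomial_in.const[of C "-1"], of f] by simp

lemma polynomial_in_diff:
  "polynomial_in C f \<Longrightarrow> polynomial_in C g \<Longrightarrow> polynomial_in C (\<lambda>x. f x - g x)"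
  using polynomial_in.add[OF _ polynomial_in_uminus, of C f g] by simp

lemma polynomial_in_sum:
  "(\<And>i. i \<in> A \<Longrightarrow> polynomial_in C (f i)) \<Longrightarrow> polynomial_in C (\<lambda>x. \<Sum>i\<in>A. f i x)"
  by (induction A rule: infinite_finite_induct) (auto intro: polynomial_in.const polynomial_in.add)

lemma polynomial_in_prod:
  "(\<And>i. i \<in> A \<Longrightarrow> polynomial_in C (f i)) \<Longrightarrow> polynomial_in C (\<lambda>x. \<Prod>i\<in>A. f i x)"
  by (induction A rule: infinite_finite_induct) (auto intro: polynomial_in.const polynomial_in.mult)

lemma polynomial_in_if:
  "(b \<Longrightarrow> polynomial_in C f) \<Longrightarrow> (\<not> b \<Longrightarrow> polynomial_in C g) \<Longrightarrow> polynomial_in C (\<lambda>x. if b then f x else g x)"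
  by (cases b) auto

lemma polynomial_in_det:
  fixes A :: "'a \<Rightarrow> real ^ 'n ^ 'n"
  assumes "\<And>i j. polynomial_in C (\<lambda>x. A x $ i $ j)"
  shows "polynomial_in C (\<lambda>x. det (A x))"
  unfolding det_def
  by (intro polynomial_in_sum polynomial_in.mult polynomial_in.const polynomial_in_prod assms)

lemma polynomial_in_compose:
  assumes "polynomial_in C f" and "\<And>g. g \<in> C \<Longrightarrow> polynomial_in D (\<lambda>x. g (h x))"
  shows "polynomial_in D (\<lambda>x. f (h x))"
  using assms(1) by induction (auto intro: assms(2) polynomial_in.intros)

lemma polynomial_in_measurable:
  assumes "polynomial_in C f" and "\<And>g. g \<in> C \<Longrightarrow> g \<in> borel_measurable M"
  shows "f \<in> borel_measurable M"
  using assms(1) by induction (auto intro: assms(2))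

lemma polynomial_in_line:
  assumes "polynomial_in {\<lambda>t. t} f"
  shows "\<exists>p. \<forall>t. f t = poly p t"
  using assms
proof induction
  case (coordinate f)
  then show ?case by (intro exI[of _ "[:0, 1:]"]) auto
next
  case (const c)
  then show ?case by (intro exI[of _ "[:c:]"]) auto
next
  case (add f g)
  then show ?case by (metis poly_add)
next
  case (mult f g)
  then show ?case by (metis poly_mult)
qed

lemma polynomial_in_line_finite_zeros:
  assumes "polynomial_in {\<lambda>t. t} f" "f t \<noteq> 0"
  shows "finite {t. f t = 0}"
proof -
  obtain p where p: "\<And>t. f t = poly p t"
    using polynomial_in_line[OF assms(1)] by auto
  then have "p \<noteq> 0" using assms(2) by auto
  then show ?thesis unfolding p by (rule poly_roots_finite)
qed

lemma polynomial_in_no_coordinates: "polynomial_in {} f \<Longrightarrow> f x = f y"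
  by (induction rule: polynomial_in.induct) auto

text \<open>Induction on the coordinates. Freezing one coordinate at its value in \<open>x\<^sub>0\<close> gives a polynomial in the
others that is nonzero almost everywhere; at each such point the polynomial in the frozen coordinate is not zero and
has finitely many roots.\<close>

lemma AE_polynomial_nonzero_PiM:
  assumes "finite J" and "polynomial_in ((\<lambda>i x. x i) ` J) f" and "f x\<^sub>0 \<noteq> 0"
  shows "AE x in (\<Pi>\<^sub>M i\<in>J. lborel). f x \<noteq> (0::real)"
  using assms
proof (induction J arbitrary: f rule: finite_induct)
  case empty
  then have "f x \<noteq> 0" for x
    using polynomial_in_no_coordinates[of f x x\<^sub>0] by simp
  then show ?case by simp
next
  case (insert i J)
  interpret product_sigma_finite "\<lambda>_. lborel :: real measure" ..
  let ?Z = "{x. f x = 0}"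
  have [measurable]: "f \<in> borel_measurable (\<Pi>\<^sub>M i\<in>insert i J. lborel)"
    by (rule polynomial_in_measurable[OF insert.prems(1)]) auto
  have "AE x in (\<Pi>\<^sub>M i\<in>J. lborel). f (x(i := x\<^sub>0 i)) \<noteq> 0"
  proof (rule insert.IH)
    show "polynomial_in ((\<lambda>i x. x i) ` J) (\<lambda>x. f (x(i := x\<^sub>0 i)))"
    proof (rule polynomial_in_compose[OF insert.prems(1)])
      fix g :: "('a \<Rightarrow> real) \<Rightarrow> real" assume "g \<in> (\<lambda>i x. x i) ` insert i J"
      then obtain j where j: "g = (\<lambda>x. x j)" "j = i \<or> j \<in> J" by auto
      show "polynomial_in ((\<lambda>i x. x i) ` J) (\<lambda>x. g (x(i := x\<^sub>0 i)))"
        using j by (cases "j = i") (auto intro: polynomial_in.const polynomial_in.coordinate)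
    qed
  qed (use insert.prems in simp)
  then have "AE x in (\<Pi>\<^sub>M i\<in>J. lborel). (\<integral>\<^sup>+ t. indicator ?Z (x(i := t)) \<partial>lborel) = 0"
  proof eventually_elim
    case (elim x)
    have "polynomial_in {\<lambda>t. t} (\<lambda>t. f (x(i := t)))"
      by (rule polynomial_in_compose[OF insert.prems(1)])
         (auto intro!: polynomial_in_if polynomial_in.const intro: polynomial_in.coordinate)
    then have "finite {t. f (x(i := t)) = 0}"
      by (rule polynomial_in_line_finite_zeros) (rule elim)
    then have "{t. f (x(i := t)) = 0} \<in> null_sets lborel"
      by (rule finite_imp_null_set_lborel)
    then have "(\<integral>\<^sup>+ t. indicator {t. f (x(i := t)) = 0} t \<partial>lborel) = 0"
      by (subst nn_integral_indicator) auto
    then show ?case by (simp add: indicator_def)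
  qed
  then have "(\<integral>\<^sup>+ x. (\<integral>\<^sup>+ t. indicator ?Z (x(i := t)) \<partial>lborel) \<partial>(\<Pi>\<^sub>M i\<in>J. lborel)) = 0"
    by (subst nn_integral_cong_AE) auto
  then have "(\<integral>\<^sup>+ x. indicator ?Z x \<partial>(\<Pi>\<^sub>M i\<in>insert i J. lborel)) = 0"
    by (subst product_nn_integral_insert) (use insert.hyps in auto)
  then show ?case
    by (subst AE_iff_nn_integral) auto
qed

definition pair_coordinates :: "'i set \<Rightarrow> 'j set \<Rightarrow> (('i \<Rightarrow> real) \<times> ('j \<Rightarrow> real) \<Rightarrow> real) set" where
  "pair_coordinates I J = (\<lambda>i p. fst p i) ` I \<union> (\<lambda>j p. snd p j) ` J"

lemma AE_polynomial_nonzero_pair: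
  assumes "finite I" "finite J" and "polynomial_in (pair_coordinates I J) f" and "f (x\<^sub>0, y\<^sub>0) \<noteq> 0"
  shows "AE p in (\<Pi>\<^sub>M i\<in>I. lborel) \<Otimes>\<^sub>M (\<Pi>\<^sub>M j\<in>J. lborel). f p \<noteq> 0"
proof -
  let ?M = "\<Pi>\<^sub>M i\<in>I. lborel :: real measure" and ?N = "\<Pi>\<^sub>M j\<in>J. lborel :: real measure"
  interpret I: finite_product_sigma_finite "\<lambda>_. lborel :: real measure" I
    by standard (rule assms)
  interpret J: finite_product_sigma_finite "\<lambda>_. lborel :: real measure" J
    by standard (rule assms)
  interpret pair_sigma_finite ?M ?N ..
  have [measurable]: "f \<in> borel_measurable (?M \<Otimes>\<^sub>M ?N)"
    by (rule polynomial_in_measurable[OF assms(3)]) (auto simp: pair_coordinates_def)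
  have "polynomial_in ((\<lambda>i x. x i) ` I) (\<lambda>x. f (x, y\<^sub>0))"
    by (rule polynomial_in_compose[OF assms(3)])
       (auto simp: pair_coordinates_def intro: polynomial_in.const polynomial_in.coordinate)
  from AE_polynomial_nonzero_PiM[OF assms(1) this assms(4)]
  have "AE x in ?M. AE y in ?N. f (x, y) \<noteq> 0"
  proof eventually_elim
    case (elim x)
    have "polynomial_in ((\<lambda>j y. y j) ` J) (\<lambda>y. f (x, y))"
      by (rule polynomial_in_compose[OF assms(3)])
         (auto simp: pair_coordinates_def intro: polynomial_in.const polynomial_in.coordinate)
    from AE_polynomial_nonzero_PiM[OF assms(2) this elim] show ?case .
  qed
  then show ?thesis
    by (intro AE_pair_measure) auto
qed


section \<open>Generic faithfulness\<close>

text \<open>The certificate \<open>\<psi>\<close> for the M-matrix property solves the equations of the system for empty \<open>Z\<close> with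
right-hand side \<open>1\<close>; they are recursions along the acyclic graph. Blocking the ball at \<open>Z\<close> only removes
nonpositive terms, and a variance \<open>- W\<close> with \<open>W\<close> above the values of \<open>\<psi>\<close> at the states \<open>Inr v\<close> makes the
reflection at \<open>Z\<close> weak enough.\<close>

lemma ball_matrix_positive_point:
  fixes a :: "real ^ 'v::finite ^ 'v"
  assumes G: "acyclic G" and a_pos: "\<And>v w. (v, w) \<in> G \<Longrightarrow> 0 < a $ v $ w"
    and a_0: "\<And>v w. (v, w) \<notin> G \<Longrightarrow> a $ v $ w = 0"
  obtains \<omega> where "invertible (ball_matrix Z (mat 1 - a) (mat 1 - a) \<omega>)"
    and "\<And>y \<xi> t. ball_matrix Z (mat 1 - a) (mat 1 - a) \<omega> *v \<xi> = axis (Inl y) 1 \<Longrightarrow>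
      bayes_ball G Z y t \<Longrightarrow> 0 < \<xi> $ t"
proof -
  have a_nonneg: "0 \<le> a $ v $ w" for v w
    using a_pos[of v w] a_0[of v w] by (cases "(v, w) \<in> G") auto
  have irr: "v \<noteq> w" if "(v, w) \<in> G" for v w
    using that G by (auto simp: acyclic_def)
  have a_diag: "a $ v $ v = 0" for v
    using irr[of v v] a_0 by blast
  define \<alpha> where "\<alpha> = matrix_inv (mat 1 - a) *v 1"
  define \<gamma> where "\<gamma> = matrix_inv (mat 1 - transpose a) *v (1 + \<alpha>)"
  have \<alpha>: "(mat 1 - a) *v \<alpha> = 1"
    using invertible_one_minus_acyclic[OF G a_0]
    by (simp add: \<alpha>_def matrix_vector_mul_assoc matrix_inv_inverse)
  have ta_0: "transpose a $ v $ w = 0" if "(v, w) \<notin> G\<inverse>" for v w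
    using that a_0 by (simp add: transpose_def)
  have G': "acyclic (G\<inverse>)" using G by simp
  have \<gamma>: "(mat 1 - transpose a) *v \<gamma> = 1 + \<alpha>"
    using invertible_one_minus_acyclic[OF G' ta_0]
    by (simp add: \<gamma>_def matrix_vector_mul_assoc matrix_inv_inverse)
  have \<alpha>_ge: "1 \<le> \<alpha> $ v" for v
    using acyclic_solution_ge[OF G a_0 a_nonneg _ \<alpha>, of v] by simp
  have \<gamma>_ge: "1 + \<alpha> $ v \<le> \<gamma> $ v" for v
    using acyclic_solution_ge[OF G' ta_0 _ _ \<gamma>, of v] \<alpha>_ge a_nonneg
    by (simp add: transpose_def add_nonneg_nonneg order_trans[OF zero_le_one])
  have \<gamma>_pos: "0 < \<gamma> $ v" for v
    using \<gamma>_ge[of v] \<alpha>_ge[of v] by linarith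
  \<comment> \<open>Since \<open>\<alpha> \<ge> 1\<close>, the row of \<open>v \<in> Z\<close> applied to \<open>\<psi>\<close> is at least \<open>W - \<gamma>\<^sub>v\<close>.\<close>
  define W where "W = 1 + (\<Sum>v\<in>UNIV. \<gamma> $ v)"
  have \<gamma>_le: "\<gamma> $ v < W" for v
    using member_le_sum[of v UNIV "\<lambda>v. \<gamma> $ v"] \<gamma>_pos by (simp add: W_def less_imp_le)
  then have W: "0 < W" using \<gamma>_pos by (meson less_trans)
  define \<omega> where "\<omega> v = (if v \<in> Z then - W else 1)" for v
  define Q where "Q = ball_matrix Z (mat 1 - a) (mat 1 - a) \<omega>"
  define \<psi> :: "real ^ ('v + 'v)" where
    "\<psi> = (\<chi> i. case i of Inl v \<Rightarrow> \<alpha> $ v | Inr v \<Rightarrow> \<gamma> $ v)"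
  have off: "Q $ i $ j \<le> 0" if "i \<noteq> j" for i j
    using that a_nonneg W
    by (auto simp: Q_def ball_matrix_def \<omega>_def mat_def split: sum.split)
  have \<psi>_pos: "0 < \<psi> $ i" for i
    using \<alpha>_ge \<gamma>_pos by (auto simp: \<psi>_def split: sum.split intro: less_le_trans[OF zero_less_one])
  have Q\<psi>_pos: "0 < (Q *v \<psi>) $ i" for i
  proof (cases i)
    case (Inl v)
    show ?thesis
    proof (cases "v \<in> Z")
      case True
      have "W * 1 \<le> W * \<alpha> $ v"
        using W \<alpha>_ge[of v] by (intro mult_left_mono) auto
      then have "\<gamma> $ v < W * \<alpha> $ v"
        using \<gamma>_le[of v] by linarith
      then show ?thesis
        using True Inl by (simp add: Q_def ball_matrix_mult_Inl \<psi>_def \<omega>_def)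
    next
      case False
      have "(\<Sum>w\<in>UNIV. (mat 1 - a) $ v $ w * \<alpha> $ w) = 1"
        using arg_cong[OF \<alpha>, of "\<lambda>x. x $ v"] by (simp add: matrix_vector_mult_def)
      then show ?thesis
        using False Inl by (simp add: Q_def ball_matrix_mult_Inl \<psi>_def)
    qed
  next
    case (Inr v)
    have "(transpose a *v \<gamma>) $ v = (\<Sum>w\<in>UNIV. a $ w $ v * \<gamma> $ w)"
      by (simp only: matrix_vector_mult_def transpose_def vec_lambda_beta)
    then have "((mat 1 - transpose a) *v \<gamma>) $ v = \<gamma> $ v - (\<Sum>w\<in>UNIV. a $ w $ v * \<gamma> $ w)"
      by (simp only: matrix_vector_mult_diff_rdistrib matrix_vector_mul_lid vector_minus_component)
    then have 1: "\<gamma> $ v - (\<Sum>w\<in>UNIV. a $ w $ v * \<gamma> $ w) = 1 + \<alpha> $ v"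
      using \<gamma> by simp
    have 2: "(\<Sum>w\<in>- Z. a $ w $ v * \<gamma> $ w) \<le> (\<Sum>w\<in>UNIV. a $ w $ v * \<gamma> $ w)"
      by (rule sum_mono2) (auto intro: mult_nonneg_nonneg a_nonneg less_imp_le \<gamma>_pos)
    have "(\<Sum>w\<in>- Z. (mat 1 - a) $ w $ v * \<gamma> $ w) =
        (\<Sum>w\<in>- Z. (if w = v then \<gamma> $ w else 0)) - (\<Sum>w\<in>- Z. a $ w $ v * \<gamma> $ w)"
      unfolding sum_subtractf[symmetric] by (intro sum.cong) (auto simp: mat_def algebra_simps)
    also have "(\<Sum>w\<in>- Z. (if w = v then \<gamma> $ w else 0)) = (if v \<in> Z then 0 else \<gamma> $ v)"
      by simp
    finally show ?thesis
      using 1 2 \<alpha>_ge[of v] Inr by (auto simp: Q_def ball_matrix_mult_Inr \<psi>_def \<omega>_def)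
  qed
  note M = off \<psi>_pos Q\<psi>_pos
  show thesis
  proof (rule that)
    show "invertible (ball_matrix Z (mat 1 - a) (mat 1 - a) \<omega>)"
      unfolding Q_def[symmetric] by (rule M_matrix_invertible[OF M])
    fix y t and \<xi> :: "real ^ ('v + 'v)"
    assume "ball_matrix Z (mat 1 - a) (mat 1 - a) \<omega> *v \<xi> = axis (Inl y) 1"
    then have Q\<xi>: "Q *v \<xi> = axis (Inl y) 1" by (simp add: Q_def)
    have rhs: "0 \<le> (Q *v \<xi>) $ i" for i
      unfolding Q\<xi> by (simp add: axis_def)
    have nonneg: "0 \<le> \<xi> $ i" for i
      by (rule M_matrix_nonneg[OF M rhs])
    have step: "0 < \<xi> $ j" if "0 < \<xi> $ i" "i \<noteq> j" "Q $ j $ i < 0" for i j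
      by (rule M_matrix_pos_step[OF off nonneg rhs that(2,3,1)])
    assume "bayes_ball G Z y t"
    then show "0 < \<xi> $ t"
    proof induction
      case source
      have "0 < (Q *v \<xi>) $ Inl y" unfolding Q\<xi> by (simp add: axis_def)
      then show ?case
        using off nonneg by (intro M_matrix_pos_source[of Q \<xi> "Inl y"]) simp_all
    next
      case (up v u)
      then show ?case
        using irr[of u v] a_pos[of u v]
        by - (rule step[of "Inl v"], auto simp: Q_def ball_matrix_def mat_def)
    next
      case (turn_down v)
      then show ?case
        by - (rule step[of "Inl v"], auto simp: Q_def ball_matrix_def \<omega>_def)
    next
      case (down v w)
      then show ?case
        using irr[of v w] a_pos[of v w]
        by - (rule step[of "Inr v"], auto simp: Q_def ball_matrix_def mat_def)
    next
      case (turn_up v)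
      then show ?case
        by - (rule step[of "Inr v"], auto simp: Q_def ball_matrix_def)
    qed
  qed
qed

definition real_ball_matrix ::
  "'v set \<Rightarrow> 'v::finite tsgraph \<Rightarrow> 'v coeffs \<times> 'v noise \<Rightarrow> real ^ ('v + 'v) ^ ('v + 'v)" where
  "real_ball_matrix Z \<G> p =
     (let P = mat 1 - (\<chi> v w. lag_sum \<G> (fst p) v w) in ball_matrix Z P P (snd p))"

definition ratfun_ball_matrix ::
  "'v set \<Rightarrow> 'v::finite tsgraph \<Rightarrow> 'v coeffs \<times> 'v noise \<Rightarrow> ratfun ^ ('v + 'v) ^ ('v + 'v)" where
  "ratfun_ball_matrix Z \<G> p =
     ball_matrix Z (lag_matrix id \<G> (fst p)) (lag_matrix rf_star \<G> (fst p)) (\<lambda>v. rf_const (snd p v))"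

text \<open>The determinant that Cramer's rule places over \<open>det Q\<close> for the coordinate \<open>Inr x\<close> of the solution of
\<open>Q \<xi> = e\<close>, with \<open>e\<close> the unit vector at \<open>Inl y\<close>.\<close>

definition cramer_numerator :: "'a::field ^ ('v + 'v) ^ ('v::finite + 'v) \<Rightarrow> 'v \<Rightarrow> 'v \<Rightarrow> 'a" where
  "cramer_numerator Q x y = det (\<chi> i j. if j = Inr x then axis (Inl y) 1 $ i else Q $ i $ j)"

lemma cramer_numerator_solution:
  assumes "Q *v \<xi> = axis (Inl y) 1"
  shows "cramer_numerator Q x y = \<xi> $ Inr x * det Q"
  using cramer_lemma[of "Inr x" Q \<xi>] unfolding assms cramer_numerator_def .

lemma polynomial_in_real_ball_matrix:
  fixes \<G> :: "'v::finite tsgraph"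
  shows "polynomial_in (pair_coordinates (lagged_edges \<G>) UNIV) (\<lambda>p. real_ball_matrix Z \<G> p $ i $ j)"
proof -
  have lag: "polynomial_in (pair_coordinates (lagged_edges \<G>) UNIV) (\<lambda>p. lag_sum \<G> (fst p) v w)" for v w
    unfolding lag_sum_def
    by (intro polynomial_in_sum polynomial_in.coordinate) (auto simp: pair_coordinates_def)
  have noise: "polynomial_in (pair_coordinates (lagged_edges \<G>) UNIV) (\<lambda>p. snd p v)" for v :: 'v
    by (intro polynomial_in.coordinate) (auto simp: pair_coordinates_def)
  show ?thesis
    by (cases i; cases j)
       (auto simp: real_ball_matrix_def ball_matrix_def mat_def Let_def
         intro!: polynomial_in_if polynomial_in_diff polynomial_in_uminus polynomial_in.const lag noise)
qed

lemma value_at_one_ball_matrix: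
  "value_at_one (ratfun_ball_matrix Z \<G> p $ i $ j) (real_ball_matrix Z \<G> p $ i $ j)"
proof -
  have *: "value_at_one (if b then r else s) (if b then c else d)"
    if "b \<Longrightarrow> value_at_one r c" "\<not> b \<Longrightarrow> value_at_one s d" for b r s c d
    using that by simp
  show ?thesis
    by (cases i; cases j)
       (auto simp: ratfun_ball_matrix_def real_ball_matrix_def ball_matrix_def lag_matrix_def mat_def Let_def
         intro!: * value_at_one_diff value_at_one_uminus value_at_one_0 value_at_one_1
           value_at_one_const value_at_one_lag_poly)
qed

text \<open>Both quantities are polynomials that do not vanish at the point of \<open>ball_matrix_positive_point\<close>. That
point has negative variances and large coefficients; being a point of the real parameter space is enough.\<close>

lemma AE_ball_matrix_generic:
  fixes \<G> :: "'v::finite tsgraph"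
  assumes G: "acyclic G" "\<G> \<in> ts_graphs G"
  shows "AE p in param_measure \<G>. det (real_ball_matrix Z \<G> p) \<noteq> 0"
    and "bayes_ball G Z y (Inr x) \<Longrightarrow>
      AE p in param_measure \<G>. cramer_numerator (real_ball_matrix Z \<G> p) x y \<noteq> 0"
proof -
  have ts: "ts_graph \<G>" and pg: "process_graph \<G> = G"
    using G by (auto simp: ts_graphs_def)
  note fin = finite_lagged_edges[OF ts]
  define \<Phi> :: "'v coeffs" where "\<Phi> = (\<lambda>(v, w, k). if v = w then 0 else 1)"
  define a where "a = (\<chi> v w. lag_sum \<G> \<Phi> v w)"
  have a: "a $ v $ w = (if v = w then 0 else real (card {k. (v, w, k) \<in> lagged_edges \<G>}))" for v w
    by (simp add: a_def lag_sum_def \<Phi>_def)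
  have "finite {k. (v, w, k) \<in> lagged_edges \<G>}" for v w
    using fin by (rule finite_surj[of _ _ "\<lambda>(v, w, k). k"]) force
  then have "0 < a $ v $ w" if "(v, w) \<in> G" for v w
    using that by (auto simp: a card_gt_0_iff simp flip: pg) (auto simp: process_graph_def)
  moreover have "a $ v $ w = 0" if "(v, w) \<notin> G" for v w
  proof -
    have "v = w \<or> {k. (v, w, k) \<in> lagged_edges \<G>} = {}"
      using that by (auto simp: process_graph_def simp flip: pg)
    then show ?thesis by (auto simp: a)
  qed
  ultimately obtain \<omega> where \<omega>: "invertible (ball_matrix Z (mat 1 - a) (mat 1 - a) \<omega>)"
    "\<And>y \<xi> t. ball_matrix Z (mat 1 - a) (mat 1 - a) \<omega> *v \<xi> = axis (Inl y) 1 \<Longrightarrow>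
      bayes_ball G Z y t \<Longrightarrow> 0 < \<xi> $ t"
    using ball_matrix_positive_point[OF G(1), of a Z] by metis
  define Q where "Q = ball_matrix Z (mat 1 - a) (mat 1 - a) \<omega>"
  have Q: "real_ball_matrix Z \<G> (\<Phi>, \<omega>) = Q"
    by (simp add: real_ball_matrix_def Q_def a_def Let_def)
  have det: "det Q \<noteq> 0"
    using \<omega>(1) by (simp add: Q_def invertible_det_nz)
  show "AE p in param_measure \<G>. det (real_ball_matrix Z \<G> p) \<noteq> 0"
    unfolding param_measure_def
    by (rule AE_polynomial_nonzero_pair[OF fin finite, where x\<^sub>0 = \<Phi> and y\<^sub>0 = \<omega>])
       (use det in \<open>auto simp: Q intro!: polynomial_in_det polynomial_in_real_ball_matrix\<close>)
  show "AE p in param_measure \<G>. cramer_numerator (real_ball_matrix Z \<G> p) x y \<noteq> 0"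
    if ball: "bayes_ball G Z y (Inr x)"
    unfolding param_measure_def
  proof (rule AE_polynomial_nonzero_pair[OF fin finite, where x\<^sub>0 = \<Phi> and y\<^sub>0 = \<omega>])
    show "polynomial_in (pair_coordinates (lagged_edges \<G>) UNIV)
        (\<lambda>p. cramer_numerator (real_ball_matrix Z \<G> p) x y)"
      unfolding cramer_numerator_def
      by (rule polynomial_in_det)
         (auto intro!: polynomial_in_if polynomial_in.const polynomial_in_real_ball_matrix)
    have inv: "invertible Q" using \<omega>(1) by (simp add: Q_def)
    then have sol: "Q *v (matrix_inv Q *v axis (Inl y) 1) = axis (Inl y) 1"
      by (simp add: matrix_vector_mul_assoc matrix_inv_inverse)
    then have "0 < (matrix_inv Q *v axis (Inl y) 1) $ Inr x"
      unfolding Q_def by (rule \<omega>(2)) (rule ball)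
    then show "cramer_numerator (real_ball_matrix Z \<G> (\<Phi>, \<omega>)) x y \<noteq> 0"
      using cramer_numerator_solution[OF sol, of x] det by (simp add: Q)
  qed
qed

lemma cond_spectrum_outside:
  "x \<notin> X \<or> y \<notin> Y \<Longrightarrow> cond_spectrum S X Y Z $ x $ y = 0"
  by (auto simp: cond_spectrum_def block_def matrix_matrix_mult_def)

text \<open>The two genericity conditions concern the point \<open>z = 1\<close>. They lift to rational functions, since a
rational function with a nonzero value there is not zero.\<close>

theorem cond_indep_iff_d_separates:
  fixes \<G> :: "'v::finite tsgraph"
  assumes G: "acyclic G" "\<G> \<in> ts_graphs G" and stb: "p \<in> param_stb \<G>"
    and dis: "disjoint_triple X Y Z"
    and det: "det (real_ball_matrix Z \<G> p) \<noteq> 0"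
    and num: "\<And>x y. bayes_ball G Z y (Inr x) \<Longrightarrow> cramer_numerator (real_ball_matrix Z \<G> p) x y \<noteq> 0"
  shows "cond_indep (spectrum \<G> (fst p) (snd p)) X Y Z \<longleftrightarrow> d_separates G Z X Y"
proof -
  let ?S = "spectrum \<G> (fst p) (snd p)" and ?Q = "ratfun_ball_matrix Z \<G> p"
  have pg: "process_graph \<G> = G"
    using G by (auto simp: ts_graphs_def)
  have acyc: "acyclic (process_graph \<G>)" using G pg by simp
  have neq1: "lag_poly \<G> (fst p) v v \<noteq> 1" for v
    using lag_poly_neq_1[of "fst p" "snd p" \<G> v] stb by simp
  note S = spectrum_factorization(1)[OF acyc neq1]
    spectrum_factorization(2)[OF acyc neq1, where \<Omega> = "snd p"]
  have "det ?Q \<noteq> 0"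
    using value_at_one_nonzero[OF value_at_one_det[OF value_at_one_ball_matrix] det] .
  then have inv: "invertible ?Q"
    by (simp add: invertible_det_nz)
  have Z: "X \<inter> Z = {}" "Y \<inter> Z = {}"
    using dis by (auto simp: disjoint_triple_def)
  have entry: "cond_spectrum ?S X Y Z $ x $ y = 0 \<longleftrightarrow> \<not> bayes_ball G Z y (Inr x)"
    if xy: "x \<in> X" "y \<in> Y" for x y
  proof -
    define \<xi> where "\<xi> = matrix_inv ?Q *v axis (Inl y) 1"
    have \<xi>: "?Q *v \<xi> = axis (Inl y) 1"
      using inv by (simp add: \<xi>_def matrix_vector_mul_assoc matrix_inv_inverse)
    have "cond_spectrum ?S X Y Z $ x $ y = \<xi> $ Inr x"
      by (rule cond_spectrum_ball_system[OF S(2,1) inv[unfolded ratfun_ball_matrix_def] xy _ _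
            \<xi>[unfolded ratfun_ball_matrix_def]]) (use xy Z in auto)
    moreover have "\<xi> $ Inr x = 0" if "\<not> bayes_ball G Z y (Inr x)"
    proof (rule ball_matrix_soundness[OF inv[unfolded ratfun_ball_matrix_def] _ _
          \<xi>[unfolded ratfun_ball_matrix_def] that])
      fix v w assume "v \<noteq> w" "(v, w) \<notin> G"
      then have "lag_poly \<G> (fst p) v w = 0"
        using lag_poly_eq_0 pg by metis
      then show "lag_matrix id \<G> (fst p) $ v $ w = 0" "lag_matrix rf_star \<G> (fst p) $ v $ w = 0"
        using \<open>v \<noteq> w\<close> rf_star_to_fract[of 0] by (simp_all add: lag_matrix_def)
    qed
    moreover have "\<xi> $ Inr x \<noteq> 0" if ball: "bayes_ball G Z y (Inr x)"
    proof -
      have "value_at_one (cramer_numerator ?Q x y) (cramer_numerator (real_ball_matrix Z \<G> p) x y)"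
        unfolding cramer_numerator_def
        by (rule value_at_one_det)
           (auto simp: axis_def value_at_one_ball_matrix value_at_one_0 value_at_one_1)
      from value_at_one_nonzero[OF this num[OF ball]] show ?thesis
        using cramer_numerator_solution[OF \<xi>, of x] by auto
    qed
    ultimately show ?thesis by auto
  qed
  have "cond_indep ?S X Y Z \<longleftrightarrow> (\<forall>x\<in>X. \<forall>y\<in>Y. cond_spectrum ?S X Y Z $ x $ y = 0)"
    using cond_spectrum_outside[of _ X _ Y ?S Z] by (auto simp: cond_indep_def vec_eq_iff)
  then show ?thesis
    using entry d_separates_iff_ball[OF G(1) Z] by auto
qed

theorem theorem1:
  fixes G :: "('v::finite) rel" and \<G> :: "'v tsgraph"
  assumes "acyclic G" and "\<G> \<in> ts_graphs G"
  shows "(\<forall>X Y Z. disjoint_triple X Y Z \<longrightarrow>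
            (AE (\<Phi>, \<Omega>) \<in> param_stb \<G> in param_measure \<G>.
               cond_indep (spectrum \<G> \<Phi> \<Omega>) X Y Z \<longleftrightarrow> d_separates G Z X Y))
       \<and> (AE (\<Phi>, \<Omega>) \<in> param_stb \<G> in param_measure \<G>.
            dsep_triples G = ci_triples (spectrum \<G> \<Phi> \<Omega>) \<and>
            markov_class G = {G'. acyclic G' \<and> dsep_triples G' = ci_triples (spectrum \<G> \<Phi> \<Omega>)})"
proof -
  have "AE p in param_measure \<G>. \<forall>Z. det (real_ball_matrix Z \<G> p) \<noteq> 0 \<and>
      (\<forall>x y. bayes_ball G Z y (Inr x) \<longrightarrow> cramer_numerator (real_ball_matrix Z \<G> p) x y \<noteq> 0)"
    unfolding AE_all_countable AE_conj_iff
    using AE_ball_matrix_generic[OF assms] by (auto intro!: AE_impI)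
  then have generic: "AE p in param_measure \<G>. p \<in> param_stb \<G> \<longrightarrow>
      (\<forall>X Y Z. disjoint_triple X Y Z \<longrightarrow>
        cond_indep (spectrum \<G> (fst p) (snd p)) X Y Z = d_separates G Z X Y)"
  proof eventually_elim
    case (elim p)
    then show ?case
      using cond_indep_iff_d_separates[OF assms] by blast
  qed
  show ?thesis
  proof (intro conjI allI impI)
    fix X Y Z :: "'v set" assume "disjoint_triple X Y Z"
    with generic show "AE (\<Phi>, \<Omega>) \<in> param_stb \<G> in param_measure \<G>.
        cond_indep (spectrum \<G> \<Phi> \<Omega>) X Y Z \<longleftrightarrow> d_separates G Z X Y"
      by (auto elim!: eventually_mono)
  next
    from generic show "AE (\<Phi>, \<Omega>) \<in> param_stb \<G> in param_measure \<G>.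
        dsep_triples G = ci_triples (spectrum \<G> \<Phi> \<Omega>) \<and>
        markov_class G = {G'. acyclic G' \<and> dsep_triples G' = ci_triples (spectrum \<G> \<Phi> \<Omega>)}"
    proof eventually_elim
      case (elim p)
      show ?case
      proof (clarify, intro conjI)
        fix \<Phi> \<Omega> assume p: "p = (\<Phi>, \<Omega>)" "(\<Phi>, \<Omega>) \<in> param_stb \<G>"
        show "dsep_triples G = ci_triples (spectrum \<G> \<Phi> \<Omega>)"
          using elim p by (auto simp: dsep_triples_def ci_triples_def)
        then show "markov_class G = {G'. acyclic G' \<and> dsep_triples G' = ci_triples (spectrum \<G> \<Phi> \<Omega>)}"
          by (auto simp: markov_class_def markov_equivalent_def)
      qed
    qed
  qed
qed

end
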